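(* Let $G$ be a graph, $S$ a symmetry group in dimension $d$, and $\Phi: S\to \mathrm{Aut}(G)$ a map such that $\mathscr{R}_{(G,S,\Phi)}\neq\emptyset$. Each of the following equivalences holds, one for each choice of the property $\mathcal{P}\in\{\text{infinitesimally rigid},\ \text{independent},\ \text{isostatic}\}$. The following are equivalent: (i) there exists a framework $(G,p)\in\mathscr{R}_{(G,S,\Phi)}$ that has property $\mathcal{P}$; (ii) every $(S,\Phi)$-generic realization of $G$ (i.e. every $(S,\Phi)$-generic framework in $\mathscr{R}_{(G,S,\Phi)}$) has property $\mathcal{P}$.
   Context: Graphs are finite, simple, with nonempty vertex set. $\mathrm{Aut}(G)$ is the group (under composition) of automorphisms of $G$. A framework in $\mathbb{R}^d$ (also called a $d$-dimensional realization of $G$) is a pair $(G,p)$ with $G$ a graph and $p:V(G)\to\mathbb{R}^d$ a map with $p(u)\neq p(v)$ whenever $\{u,v\}\in E(G)$; $p$ need not be injective. A symmetry operation of $(G,p)$ is an isometry $x$ of $\mathbb{R}^d$ such that for some $\alpha\in\mathrm{Aut}(G)$, $x(p(v))=p(\alpha(v))$ for all $v\in V(G)$. The point group of $(G,p)$ is the group of all its symmetry operations. A symmetry group in dimension $d$ is a subgroup of the orthogonal group $O(\mathbb{R}^d)$. $\mathscr{R}_{(G,S)}$ is the set of all $d$-dimensional realizations of $G$ whose point group equals $S$ or contains $S$ as a subgroup. For a map $\Phi:S\to\mathrm{Aut}(G)$ (not necessarily a homomorphism), $\mathscr{R}_{(G,S,\Phi)}$ is the set of all $(G,p)\in\mathscr{R}_{(G,S)}$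 with $x(p(v))=p(\Phi(x)(v))$ for all $v\in V(G)$ and all $x\in S$. Let $V(G)=\{v_1,\dots,v_n\}$, write $p_i=p(v_i)$, and identify $p$ with a vector in $\mathbb{R}^{dn}$. Rigidity. An infinitesimal motion of $(G,p)$ is a function $u:V(G)\to\mathbb{R}^d$ with $(p_i-p_j)\cdot(u(v_i)-u(v_j))=0$ for all $\{v_i,v_j\}\in E(G)$. It is trivial if there are differentiable functions $P_i:[0,1]\to\mathbb{R}^d$, $i=1,\dots,n$, with $P_i(0)=p_i$, $\|P_i(t)-P_j(t)\|=\|p_i-p_j\|$ for all $t\in[0,1]$ and all $1\le i<j\le n$, and $u(v_i)=P_i'(0)$ for all $i$. $(G,p)$ is infinitesimally rigid if every infinitesimal motion of it is trivial. For any map $p:V(G)\to\mathbb{R}^d$, the rigidity matrix $\mathbf{R}(G,p)$ is the $|E(G)|\times dn$ matrix having, for each edge $\{v_i,v_j\}$, a row with the entries of $p_i-p_j$ in columns $d(i-1)+1,\dots,di$, the entries of $p_j-p_i$ in columns $d(j-1)+1,\dots,dj$, and $0$ elsewhere. $(G,p)$ is independent if the rows of $\mathbf{R}(G,p)$ are linearly independent, and isostatic if it is infinitesimally rigid and independent. Symmetry-generic. Let $U\subseteq\mathbb{R}^{dn}$ be the linear subspace of all $(p_1,\dots,p_n)$ such that the corresponding map $p$, $p(v_i)=p_i$, satisfies $x(p(v))=p(\Phi(x)(v))$ for all $v\in V(G)$, $x\in S$. Let $K_n$ be the complete graph on $V(G)$, and let $\mathbf{R}(n,d)$ be the matrix obtained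 from $\mathbf{R}(K_n,p)$ by replacing each coordinate $(p_i)_j$ by a variable $(p_i')_j$. For a basis $\mathscr{B}_U=\{u_1,\dots,u_k\}$ of $U$, let $\mathbf{R}_{\mathscr{B}_U}(n,d)$ be the matrix obtained from $\mathbf{R}(n,d)$ by replacing each $(p'_i)_j$ with $\sum_{l=1}^k t'_l\,(u_l)_{d(i-1)+j}$, where $t'_1,\dots,t'_k$ are variables. A map $p:V(G)\to\mathbb{R}^d$ is $(S,\Phi,\mathscr{B}_U)$-generic if, whenever the determinant of a (square) submatrix of $\mathbf{R}(K_n,p)$ is zero, the determinant of the corresponding submatrix of $\mathbf{R}_{\mathscr{B}_U}(n,d)$ is the zero polynomial. A framework $(G,p)\in\mathscr{R}_{(G,S,\Phi)}$ is $(S,\Phi)$-generic if $p$ is $(S,\Phi,\mathscr{B}_U)$-generic for some basis $\mathscr{B}_U$ of $U$. *)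

theory Defs
  imports
    "HOL-Analysis.Analysis"
    "HOL-Algebra.Group"
    "HOL-Library.Poly_Mapping"
    "Jordan_Normal_Form.Determinant"
begin

text \<open>Jordan_Normal_Form declares a second \<open>$\<close>; here it always selects a component of an element
  of the type \<open>real ^ 'n\<close>.\<close>

no_notation Matrix.vec_index (infixl "$" 100)

text \<open>The vertex set of a graph is a whole finite type \<open>'v\<close>, so a graph is given by its edge
  set, and a framework on it by a map \<open>p\<close> on \<open>'v\<close>.\<close>

definition simple_graph :: "'v::finite set set \<Rightarrow> bool" where
  "simple_graph E \<longleftrightarrow> (\<forall>e\<in>E. card e = 2)"

definition complete_edges :: "'v::finite set set" where
  "complete_edges = {e. card e = 2}"

definition graph_automorphisms :: "'v::finite set set \<Rightarrow> ('v \<Rightarrow> 'v) set" where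
  "graph_automorphisms E = {\<alpha>. bij \<alpha> \<and> (\<forall>u v. {u, v} \<in> E \<longleftrightarrow> {\<alpha> u, \<alpha> v} \<in> E)}"

definition framework :: "'v::finite set set \<Rightarrow> ('v \<Rightarrow> real ^ 'd) \<Rightarrow> bool" where
  "framework E p \<longleftrightarrow> (\<forall>u v. {u, v} \<in> E \<longrightarrow> p u \<noteq> p v)"


subsection \<open>Symmetry\<close>

definition symmetry_operation ::
    "'v::finite set set \<Rightarrow> ('v \<Rightarrow> real ^ 'd) \<Rightarrow> (real ^ 'd \<Rightarrow> real ^ 'd) \<Rightarrow> bool" where
  "symmetry_operation E p x \<longleftrightarrow>
     (\<forall>a b. dist (x a) (x b) = dist a b) \<and>
     (\<exists>\<alpha>\<in>graph_automorphisms E. \<forall>v. x (p v) = p (\<alpha> v))"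

definition point_group ::
    "'v::finite set set \<Rightarrow> ('v \<Rightarrow> real ^ 'd) \<Rightarrow> (real ^ 'd \<Rightarrow> real ^ 'd) monoid" where
  "point_group E p = \<lparr>carrier = {x. symmetry_operation E p x}, mult = (\<circ>), one = id\<rparr>"

definition orthogonal_group :: "(real ^ 'd \<Rightarrow> real ^ 'd) monoid" where
  "orthogonal_group = \<lparr>carrier = {x. orthogonal_transformation x}, mult = (\<circ>), one = id\<rparr>"

definition symmetry_group :: "(real ^ 'd \<Rightarrow> real ^ 'd) set \<Rightarrow> bool" where
  "symmetry_group S \<longleftrightarrow> subgroup S orthogonal_group"

definition realizations ::
    "'v::finite set set \<Rightarrow> (real ^ 'd \<Rightarrow> real ^ 'd) set \<Rightarrow> ('v \<Rightarrow> real ^ 'd) set" where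
  "realizations E S = {p. framework E p \<and> subgroup S (point_group E p)}"

definition realizations_of_type ::
    "'v::finite set set \<Rightarrow> (real ^ 'd \<Rightarrow> real ^ 'd) set \<Rightarrow>
     ((real ^ 'd \<Rightarrow> real ^ 'd) \<Rightarrow> 'v \<Rightarrow> 'v) \<Rightarrow> ('v \<Rightarrow> real ^ 'd) set" where
  "realizations_of_type E S \<Phi> =
     {p \<in> realizations E S. \<forall>v. \<forall>x\<in>S. x (p v) = p (\<Phi> x v)}"


subsection \<open>Rigidity\<close>

definition infinitesimal_motion ::
    "'v::finite set set \<Rightarrow> ('v \<Rightarrow> real ^ 'd) \<Rightarrow> ('v \<Rightarrow> real ^ 'd) \<Rightarrow> bool" where
  "infinitesimal_motion E p u \<longleftrightarrow>
     (\<forall>v w. {v, w} \<in> E \<longrightarrow> (p v - p w) \<bullet> (u v - u w) = 0)"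

definition trivial_motion ::
    "('v::finite \<Rightarrow> real ^ 'd) \<Rightarrow> ('v \<Rightarrow> real ^ 'd) \<Rightarrow> bool" where
  "trivial_motion p u \<longleftrightarrow>
     (\<exists>P :: 'v \<Rightarrow> real \<Rightarrow> real ^ 'd.
        (\<forall>v. P v differentiable_on {0..1}) \<and>
        (\<forall>v. P v 0 = p v) \<and>
        (\<forall>t\<in>{0..1}. \<forall>v w. norm (P v t - P w t) = norm (p v - p w)) \<and>
        (\<forall>v. (P v has_vector_derivative u v) (at 0 within {0..1})))"

definition infinitesimally_rigid :: "'v::finite set set \<Rightarrow> ('v \<Rightarrow> real ^ 'd) \<Rightarrow> bool" where
  "infinitesimally_rigid E p \<longleftrightarrow> (\<forall>u. infinitesimal_motion E p u \<longrightarrow> trivial_motion p u)"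

text \<open>Rows of the rigidity matrix are indexed by edges and columns by pairs (vertex, coordinate).
  The entries are taken from an arbitrary ring, so that the coordinates \<open>q v j\<close> of the vertices
  can be real numbers as well as polynomials. For an edge \<open>e\<close> at \<open>v\<close> the definite description
  denotes the other end of \<open>e\<close>.\<close>

definition rigidity_entry ::
    "('v::finite \<Rightarrow> 'd::finite \<Rightarrow> 'a::comm_ring_1) \<Rightarrow> 'v set \<Rightarrow> 'v \<times> 'd \<Rightarrow> 'a" where
  "rigidity_entry q e = (\<lambda>(v, j). if v \<in> e then q v j - q (THE w. e = {v, w}) j else 0)"

definition rigidity_row :: "('v::finite \<Rightarrow> real ^ 'd) \<Rightarrow> 'v set \<Rightarrow> real ^ ('v \<times> 'd)" where
  "rigidity_row p e = (\<chi> c. rigidity_entry (\<lambda>v j. p v $ j) e c)"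

text \<open>Injectivity is needed because the rows form a family, whereas \<open>independent\<close> is about sets.\<close>

definition independent_framework :: "'v::finite set set \<Rightarrow> ('v \<Rightarrow> real ^ 'd) \<Rightarrow> bool" where
  "independent_framework E p \<longleftrightarrow>
     inj_on (rigidity_row p) E \<and> independent (rigidity_row p ` E)"

definition isostatic :: "'v::finite set set \<Rightarrow> ('v \<Rightarrow> real ^ 'd) \<Rightarrow> bool" where
  "isostatic E p \<longleftrightarrow> infinitesimally_rigid E p \<and> independent_framework E p"


subsection \<open>Symmetry-generic frameworks\<close>

definition symmetric_subspace ::
    "(real ^ 'd \<Rightarrow> real ^ 'd) set \<Rightarrow> ((real ^ 'd \<Rightarrow> real ^ 'd) \<Rightarrow> 'v::finite \<Rightarrow> 'v) \<Rightarrow>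
     (real ^ 'd ^ 'v) set" where
  "symmetric_subspace S \<Phi> = {q. \<forall>v. \<forall>x\<in>S. x (q $ v) = q $ (\<Phi> x v)}"

definition is_basis_list :: "'a::real_vector list \<Rightarrow> 'a set \<Rightarrow> bool" where
  "is_basis_list us U \<longleftrightarrow> distinct us \<and> independent (set us) \<and> span (set us) = U"

text \<open>Real polynomials in variables indexed by natural numbers, as finitely supported maps from
  monomials (finitely supported exponent maps) to coefficients; the ring operations are those of
  \<open>HOL-Library.Poly_Mapping\<close>.\<close>

type_synonym real_mpoly = "(nat \<Rightarrow>\<^sub>0 nat) \<Rightarrow>\<^sub>0 real"

definition poly_const :: "real \<Rightarrow> real_mpoly" where
  "poly_const c = Poly_Mapping.single 0 c"

definition poly_var :: "nat \<Rightarrow> real_mpoly" where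
  "poly_var l = Poly_Mapping.single (Poly_Mapping.single l 1) 1"

text \<open>The substitution turning the matrix of indeterminate coordinates into the one belonging to
  the basis \<open>us\<close>: coordinate \<open>j\<close> of vertex \<open>v\<close> becomes a linear form in the variables.\<close>

definition basis_coordinate ::
    "(real ^ 'd ^ 'v) list \<Rightarrow> 'v::finite \<Rightarrow> 'd::finite \<Rightarrow> real_mpoly" where
  "basis_coordinate us v j = (\<Sum>l<length us. poly_var l * poly_const (us ! l $ v $ j))"

text \<open>A submatrix is selected by listing distinct rows and columns. Listing the same rows and
  columns in another order only changes the sign of the determinant.\<close>

definition submatrix_det ::
    "('r \<Rightarrow> 'c \<Rightarrow> 'a::comm_ring_1) \<Rightarrow> 'r list \<Rightarrow> 'c list \<Rightarrow> 'a" where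
  "submatrix_det A rs cs =
     Determinant.det (Matrix.mat (length rs) (length cs) (\<lambda>(i, j). A (rs ! i) (cs ! j)))"

definition basis_generic :: "(real ^ 'd ^ 'v) list \<Rightarrow> ('v::finite \<Rightarrow> real ^ 'd) \<Rightarrow> bool" where
  "basis_generic us p \<longleftrightarrow>
     (\<forall>(rs :: 'v set list) (cs :: ('v \<times> 'd) list).
        distinct rs \<and> set rs \<subseteq> complete_edges \<and> distinct cs \<and> length rs = length cs \<longrightarrow>
        submatrix_det (rigidity_entry (\<lambda>v j. p v $ j)) rs cs = 0 \<longrightarrow>
        submatrix_det (rigidity_entry (basis_coordinate us)) rs cs = 0)"

definition symmetry_generic ::
    "'v::finite set set \<Rightarrow> (real ^ 'd \<Rightarrow> real ^ 'd) set \<Rightarrow>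
     ((real ^ 'd \<Rightarrow> real ^ 'd) \<Rightarrow> 'v \<Rightarrow> 'v) \<Rightarrow> ('v \<Rightarrow> real ^ 'd) \<Rightarrow> bool" where
  "symmetry_generic E S \<Phi> p \<longleftrightarrow>
     p \<in> realizations_of_type E S \<Phi> \<and>
     (\<exists>us. is_basis_list us (symmetric_subspace S \<Phi>) \<and> basis_generic us p)"

end

theory Submission
  imports Defs
begin

text \<open>The minors of the rigidity matrix, restricted to the symmetric subspace, are polynomials in
  the coordinates with respect to a basis. Hence every family of edges of the complete graph whose
  rows are independent at some symmetric configuration \<open>q\<close> has independent rows at a generic
  \<open>p\<close>, and \<open>p\<close> has at most as many infinitesimal motions as \<open>q\<close>. For rigidity the spaces of
  trivial motions must be compared too. The rows of the complete graph on a set of vertices are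
  independent iff these vertices are in affinely independent position, so a maximal set that is
  affinely independent at \<open>q\<close> remains so at \<open>p\<close>, and \<open>p\<close> has at least as many trivial motions as
  \<open>q\<close>. If \<open>q\<close> is rigid, both counts coincide at \<open>p\<close>. Generic configurations exist because finitely
  many nonzero real polynomials have a common point where none of them vanishes; they are frameworks
  since two adjacent vertices coincide only if the row of their edge vanishes.\<close>

no_notation scalar_prod (infix "\<bullet>" 70)

subsection \<open>Evaluation of polynomials\<close>

definition monom_eval :: "(nat \<Rightarrow> real) \<Rightarrow> (nat \<Rightarrow>\<^sub>0 nat) \<Rightarrow> real" where
  "monom_eval x m = (\<Prod>l\<in>Poly_Mapping.keys m. x l ^ Poly_Mapping.lookup m l)"

definition mpoly_eval :: "(nat \<Rightarrow> real) \<Rightarrow> real_mpoly \<Rightarrow> real" where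
  "mpoly_eval x f = (\<Sum>m\<in>Poly_Mapping.keys f. Poly_Mapping.lookup f m * monom_eval x m)"

lemma monom_eval_superset:
  assumes "finite A" "Poly_Mapping.keys m \<subseteq> A"
  shows "monom_eval x m = (\<Prod>l\<in>A. x l ^ Poly_Mapping.lookup m l)"
  unfolding monom_eval_def
  by (rule prod.mono_neutral_left) (use assms in \<open>auto simp: in_keys_iff\<close>)

lemma monom_eval_zero [simp]: "monom_eval x 0 = 1"
  by (simp add: monom_eval_def)

lemma monom_eval_add: "monom_eval x (m + n) = monom_eval x m * monom_eval x n"
proof -
  let ?A = "Poly_Mapping.keys m \<union> Poly_Mapping.keys n"
  have "monom_eval x (m + n) = (\<Prod>l\<in>?A. x l ^ Poly_Mapping.lookup (m + n) l)"
    by (rule monom_eval_superset) (simp_all add: Poly_Mapping.keys_add)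
  also have "\<dots> = (\<Prod>l\<in>?A. x l ^ Poly_Mapping.lookup m l) * (\<Prod>l\<in>?A. x l ^ Poly_Mapping.lookup n l)"
    by (simp add: lookup_add power_add prod.distrib)
  also have "\<dots> = monom_eval x m * monom_eval x n"
    by (simp add: monom_eval_superset[of ?A])
  finally show ?thesis .
qed

lemma mpoly_eval_superset:
  assumes "finite A" "Poly_Mapping.keys f \<subseteq> A"
  shows "mpoly_eval x f = (\<Sum>m\<in>A. Poly_Mapping.lookup f m * monom_eval x m)"
  unfolding mpoly_eval_def
  by (rule sum.mono_neutral_left) (use assms in \<open>auto simp: in_keys_iff\<close>)

lemma mpoly_eval_zero [simp]: "mpoly_eval x 0 = 0"
  by (simp add: mpoly_eval_def)

lemma mpoly_eval_single [simp]:
  "mpoly_eval x (Poly_Mapping.single m c) = c * monom_eval x m"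
  by (simp add: mpoly_eval_def)

lemma mpoly_eval_add: "mpoly_eval x (f + g) = mpoly_eval x f + mpoly_eval x g"
proof -
  let ?A = "Poly_Mapping.keys f \<union> Poly_Mapping.keys g"
  have "mpoly_eval x (f + g) = (\<Sum>m\<in>?A. Poly_Mapping.lookup (f + g) m * monom_eval x m)"
    by (rule mpoly_eval_superset) (simp_all add: Poly_Mapping.keys_add)
  also have "\<dots> = (\<Sum>m\<in>?A. Poly_Mapping.lookup f m * monom_eval x m)
      + (\<Sum>m\<in>?A. Poly_Mapping.lookup g m * monom_eval x m)"
    by (simp add: lookup_add distrib_right sum.distrib)
  also have "\<dots> = mpoly_eval x f + mpoly_eval x g"
    by (simp add: mpoly_eval_superset[of ?A])
  finally show ?thesis .
qed

text \<open>Inserting a coefficient at a fresh key amounts to adding a single term, so sums of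
  single terms reach every polynomial. This reduces multiplicativity of evaluation to products of
  single terms.\<close>

lemma mpoly_induct [case_names single add]:
  fixes f :: real_mpoly
  assumes single: "\<And>m c. P (Poly_Mapping.single m c)"
    and add: "\<And>f g. P f \<Longrightarrow> P g \<Longrightarrow> P (f + g)"
  shows "P f"
proof (induction f rule: update_induct)
  case const
  show ?case using single[of 0 0] by simp
next
  case (update f m c)
  have "Poly_Mapping.update m c f = f + Poly_Mapping.single m c"
    by (rule poly_mapping_eqI)
      (use update in \<open>auto simp: lookup_update lookup_add lookup_single in_keys_iff when_def\<close>)
  then show ?case using add[OF update(3) single] by simp
qed

lemma mpoly_eval_mult: "mpoly_eval x (f * g) = mpoly_eval x f * mpoly_eval x g"
proof (induction f rule: mpoly_induct)
  case (single m c)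
  show ?case
    by (induction g rule: mpoly_induct)
      (simp_all add: mult_single monom_eval_add mpoly_eval_add distrib_left)
next
  case (add f g)
  then show ?case by (simp add: mpoly_eval_add distrib_right)
qed

lemma mpoly_eval_one [simp]: "mpoly_eval x 1 = 1"
  unfolding single_one[symmetric] by (simp del: single_one)

lemma comm_ring_hom_mpoly_eval: "comm_ring_hom (mpoly_eval x)"
  by unfold_locales (simp_all add: mpoly_eval_add mpoly_eval_mult)

section \<open>Common nonzeros of finitely many polynomials\<close>

text \<open>Reduction modulo \<open>N\<close> recovers the lowest digit; cancelling it and dividing
  by \<open>N\<close> leaves one digit fewer. Applied to exponent vectors, this separates the
  monomials in Kronecker's substitution.\<close>

lemma digit_expansion_inject:
  fixes f g :: "nat \<Rightarrow> nat"
  assumes "\<And>l. l < L \<Longrightarrow> f l < N" "\<And>l. l < L \<Longrightarrow> g l < N"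
    and "(\<Sum>l<L. f l * N ^ l) = (\<Sum>l<L. g l * N ^ l)" "l < L"
  shows "f l = g l"
  using assms
proof (induction L arbitrary: f g l)
  case 0
  then show ?case by simp
next
  case (Suc L)
  have *: "(\<Sum>l<Suc L. h l * N ^ l) = h 0 + N * (\<Sum>l<L. h (Suc l) * N ^ l)" for h :: "nat \<Rightarrow> nat"
    by (simp only: sum.lessThan_Suc_shift) (simp add: sum_distrib_left mult_ac)
  have N: "N > 0" using Suc.prems(1)[of 0] by simp
  have eq: "f 0 + N * (\<Sum>l<L. f (Suc l) * N ^ l) = g 0 + N * (\<Sum>l<L. g (Suc l) * N ^ l)"
    using Suc.prems(3) unfolding * .
  from arg_cong[OF eq, of "\<lambda>a. a mod N"] have 0: "f 0 = g 0"
    using Suc.prems(1)[of 0] Suc.prems(2)[of 0] by simp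
  with eq N have "(\<Sum>l<L. f (Suc l) * N ^ l) = (\<Sum>l<L. g (Suc l) * N ^ l)"
    by simp
  then have "f (Suc l') = g (Suc l')" if "l' < L" for l'
    by (intro Suc.IH[of "\<lambda>l. f (Suc l)" "\<lambda>l. g (Suc l)"] Suc.prems(1,2)) (use that in simp_all)
  with 0 Suc.prems(4) show ?case by (cases l) auto
qed

text \<open>Kronecker's substitution: with \<open>x\<^sub>l = t\<^bsup>N^l\<^esup>\<close> and \<open>N\<close> larger than all exponents,
  distinct monomials become distinct powers of \<open>t\<close>.\<close>

lemma exists_common_nonzero:
  fixes F :: "real_mpoly set"
  assumes "finite F" "0 \<notin> F"
  shows "\<exists>x. \<forall>f\<in>F. mpoly_eval x f \<noteq> 0"
proof -
  define M where "M = (\<Union>f\<in>F. Poly_Mapping.keys f)"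
  have finM: "finite M" unfolding M_def using assms(1) by simp
  define V where "V = (\<Union>m\<in>M. Poly_Mapping.keys m)"
  have finV: "finite V" unfolding V_def using finM by simp
  obtain L where L: "V \<subseteq> {..<L}"
    using finV finite_nat_iff_bounded by blast
  \<comment> \<open>\<open>L\<close> bounds the variables and \<open>N\<close> the exponents
    occurring in \<open>F\<close>, so that one substitution serves the whole family.\<close>
  have "finite (\<Union>m\<in>M. Poly_Mapping.lookup m ` {..<L})" using finM by simp
  then obtain N where N: "(\<Union>m\<in>M. Poly_Mapping.lookup m ` {..<L}) \<subseteq> {..<N}"
    using finite_nat_iff_bounded by blast
  define \<phi> where "\<phi> m = (\<Sum>l<L. Poly_Mapping.lookup m l * N ^ l)" for m
  have inj: "inj_on \<phi> M"
  proof
    fix m n assume mn: "m \<in> M" "n \<in> M" "\<phi> m = \<phi> n"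
    show "m = n"
    proof (rule poly_mapping_eqI)
      fix l
      show "Poly_Mapping.lookup m l = Poly_Mapping.lookup n l"
      proof (cases "l < L")
        case True
        then show ?thesis
          by (intro digit_expansion_inject[of L "Poly_Mapping.lookup m" N "Poly_Mapping.lookup n"])
            (use mn N in \<open>auto simp: \<phi>_def\<close>)
      next
        case False
        then have "l \<notin> V" using L by auto
        then have "l \<notin> Poly_Mapping.keys m" "l \<notin> Poly_Mapping.keys n"
          using mn by (auto simp: V_def)
        then show ?thesis by (simp add: in_keys_iff)
      qed
    qed
  qed
  define x where "x t l = t ^ (N ^ l)" for t :: real and l
  define h where "h f = (\<Sum>m\<in>Poly_Mapping.keys f. Polynomial.monom (Poly_Mapping.lookup f m) (\<phi> m))"
    for f :: real_mpoly
  have eval: "mpoly_eval (x t) f = poly (h f) t" if "f \<in> F" for f t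
  proof -
    have "monom_eval (x t) m = t ^ \<phi> m" if "m \<in> Poly_Mapping.keys f" for m
    proof -
      have "Poly_Mapping.keys m \<subseteq> {..<L}"
        using L \<open>f \<in> F\<close> that by (auto simp: V_def M_def)
      then have "monom_eval (x t) m = (\<Prod>l<L. x t l ^ Poly_Mapping.lookup m l)"
        by (intro monom_eval_superset) auto
      also have "\<dots> = t ^ \<phi> m"
        by (simp add: x_def \<phi>_def power_sum power_mult[symmetric] mult.commute)
      finally show ?thesis .
    qed
    then show ?thesis
      by (simp add: mpoly_eval_def h_def poly_sum Polynomial.poly_monom)
  qed
  have "h f \<noteq> 0" if "f \<in> F" for f
  proof -
    from that assms(2) obtain m where m: "m \<in> Poly_Mapping.keys f"
      by (metis keys_eq_empty all_not_in_conv)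
    \<comment> \<open>By injectivity of \<open>\<phi>\<close> no other monomial of \<open>f\<close>
      can cancel the one in degree \<open>\<phi> m\<close>.\<close>
    have "poly.coeff (h f) (\<phi> m) = (\<Sum>n\<in>Poly_Mapping.keys f. if n = m then Poly_Mapping.lookup f n else 0)"
      unfolding h_def coeff_sum
      by (rule sum.cong) (use inj m that in \<open>auto simp: M_def inj_on_def\<close>)
    also have "\<dots> \<noteq> 0" using m by (simp add: in_keys_iff)
    finally show ?thesis by auto
  qed
  then have "finite (\<Union>f\<in>F. {t. poly (h f) t = 0})"
    using assms(1) poly_roots_finite by auto
  then obtain t where "t \<notin> (\<Union>f\<in>F. {t. poly (h f) t = 0})"
    using ex_new_if_finite infinite_UNIV_char_0 by blast
  then show ?thesis using eval by (intro exI[of _ "x t"]) auto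
qed

section \<open>Minors as polynomials on the symmetric subspace\<close>

lemma mpoly_eval_sum: "mpoly_eval x (sum f A) = (\<Sum>a\<in>A. mpoly_eval x (f a))"
  by (induction A rule: infinite_finite_induct) (simp_all add: mpoly_eval_add)

lemma mpoly_eval_diff: "mpoly_eval x (f - g) = mpoly_eval x f - mpoly_eval x g"
  using mpoly_eval_add[of x "f - g" g] by simp

lemma mpoly_eval_basis_coordinate:
  "mpoly_eval x (basis_coordinate us v j) = (\<Sum>l<length us. x l *\<^sub>R us ! l) $ v $ j"
  by (simp add: basis_coordinate_def mpoly_eval_sum mpoly_eval_mult poly_var_def poly_const_def
      monom_eval_def del: mult_single)

text \<open>Evaluation is a ring homomorphism, so it may be applied to the entries before the
  determinant is taken.\<close>

lemma mpoly_eval_minor: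
  "mpoly_eval x (submatrix_det (rigidity_entry (basis_coordinate us)) rs cs) =
   submatrix_det (rigidity_entry (\<lambda>v j. (\<Sum>l<length us. x l *\<^sub>R us ! l) $ v $ j)) rs cs"
proof -
  interpret comm_ring_hom "mpoly_eval x" by (rule comm_ring_hom_mpoly_eval)
  have "mpoly_eval x (rigidity_entry (basis_coordinate us) e c) =
      rigidity_entry (\<lambda>v j. (\<Sum>l<length us. x l *\<^sub>R us ! l) $ v $ j) e c" for e c
    by (cases c) (simp add: rigidity_entry_def mpoly_eval_diff mpoly_eval_basis_coordinate)
  then have "map_mat (mpoly_eval x) (Matrix.mat (length rs) (length cs)
        (\<lambda>(i, j). rigidity_entry (basis_coordinate us) (rs ! i) (cs ! j))) =
      Matrix.mat (length rs) (length cs)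
        (\<lambda>(i, j). rigidity_entry (\<lambda>v j. (\<Sum>l<length us. x l *\<^sub>R us ! l) $ v $ j) (rs ! i) (cs ! j))"
    by (intro eq_matI) auto
  then show ?thesis by (simp only: submatrix_det_def hom_det[symmetric])
qed

lemma basis_list_expansion:
  assumes "is_basis_list us U" "q \<in> U"
  shows "\<exists>x. q = (\<Sum>l<length us. x l *\<^sub>R us ! l)"
proof -
  from assms have "q \<in> span (set us)" by (simp add: is_basis_list_def)
  then obtain a where "q = (\<Sum>u\<in>set us. a u *\<^sub>R u)"
    by (auto simp: span_finite)
  also have "\<dots> = (\<Sum>l<length us. a (us ! l) *\<^sub>R us ! l)"
    using assms(1) by (intro sum.reindex_bij_betw[OF bij_betw_nth, symmetric]) (auto simp: is_basis_list_def)
  finally show ?thesis by (intro exI[of _ "\<lambda>l. a (us ! l)"])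
qed

text \<open>A nonzero value of the minor at \<open>q\<close> certifies that the corresponding
  polynomial is not zero; genericity of \<open>p\<close> is then used in contrapositive
  form.\<close>

lemma basis_generic_minor_nonzero:
  assumes "is_basis_list us U" "q \<in> U" "basis_generic us p"
    and "distinct rs" "set rs \<subseteq> complete_edges" "distinct cs" "length rs = length cs"
    and "submatrix_det (rigidity_entry (\<lambda>v j. q $ v $ j)) rs cs \<noteq> 0"
  shows "submatrix_det (rigidity_entry (\<lambda>v j. p v $ j)) rs cs \<noteq> 0"
proof
  assume "submatrix_det (rigidity_entry (\<lambda>v j. p v $ j)) rs cs = 0"
  with assms have "submatrix_det (rigidity_entry (basis_coordinate us)) rs cs = 0"
    unfolding basis_generic_def by blast
  moreover obtain x where "q = (\<Sum>l<length us. x l *\<^sub>R us ! l)"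
    using basis_list_expansion[OF assms(1,2)] by blast
  ultimately show False
    using assms(8) mpoly_eval_minor[of x us rs cs] by simp
qed

lemma finite_distinct_lists:
  "finite {xs :: 'a::finite list. distinct xs}"
  using finite_subset_distinct[of "UNIV :: 'a set"] by simp

text \<open>Distinct lists over a finite type are finite in number, so only finitely many minors
  occur; a common point where the nonzero ones do not vanish gives the coordinates of the
  configuration.\<close>

lemma exists_basis_generic:
  fixes us :: "(real ^ 'd ^ 'v) list"
  assumes "is_basis_list us U"
  shows "\<exists>q\<in>U. basis_generic us (\<lambda>v. q $ v)"
proof -
  define F where "F = (\<lambda>(rs, cs). submatrix_det (rigidity_entry (basis_coordinate us)) rs cs) `
    ({rs. distinct rs} \<times> {cs. distinct cs}) - {0}"
  have "finite F" unfolding F_def by (intro finite_Diff finite_imageI finite_cartesian_product finite_distinct_lists)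
  moreover have "0 \<notin> F" by (simp add: F_def)
  ultimately obtain x where x: "\<forall>f\<in>F. mpoly_eval x f \<noteq> 0"
    using exists_common_nonzero by blast
  let ?q = "\<Sum>l<length us. x l *\<^sub>R us ! l"
  have "?q \<in> span (set us)"
    by (intro span_sum span_scale span_base) auto
  then have "?q \<in> U" using assms by (simp add: is_basis_list_def)
  moreover have "basis_generic us (\<lambda>v. ?q $ v)"
    unfolding basis_generic_def
  proof (intro allI impI)
    fix rs :: "'v set list" and cs :: "('v \<times> 'd) list"
    assume "distinct rs \<and> set rs \<subseteq> complete_edges \<and> distinct cs \<and> length rs = length cs"
      and "submatrix_det (rigidity_entry (\<lambda>v j. ?q $ v $ j)) rs cs = 0"
    then show "submatrix_det (rigidity_entry (basis_coordinate us)) rs cs = 0"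
      using x mpoly_eval_minor[of x us rs cs] by (force simp: F_def)
  qed
  ultimately show ?thesis by blast
qed

subsection \<open>Linear independence and minors\<close>

text \<open>Coefficients belong to indices, not to vectors, so a repeated row counts as a
  dependence, as it does in a matrix.\<close>

definition independent_family :: "('i \<Rightarrow> 'a::real_vector) \<Rightarrow> 'i set \<Rightarrow> bool" where
  "independent_family f F \<longleftrightarrow> (\<forall>a. (\<Sum>i\<in>F. a i *\<^sub>R f i) = 0 \<longrightarrow> (\<forall>i\<in>F. a i = 0))"

lemma independent_family_iff:
  assumes "finite F"
  shows "independent_family f F \<longleftrightarrow> inj_on f F \<and> independent (f ` F)"
proof
  assume f: "independent_family f F"
  have inj: "inj_on f F"
  proof
    fix i j assume ij: "i \<in> F" "j \<in> F" "f i = f j"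
    show "i = j"
    proof (rule ccontr)
      assume "i \<noteq> j"
      let ?a = "\<lambda>k. if k = i then 1 else if k = j then -1 else 0 :: real"
      have "(\<Sum>k\<in>F. ?a k *\<^sub>R f k) = (\<Sum>k\<in>{i, j}. ?a k *\<^sub>R f k)"
        by (rule sum.mono_neutral_right) (use assms ij in auto)
      also have "\<dots> = 0" using \<open>i \<noteq> j\<close> ij by simp
      finally show False
        using f[unfolded independent_family_def, rule_format, of ?a i] ij(1) by simp
    qed
  qed
  moreover have "independent (f ` F)"
  proof
    assume "dependent (f ` F)"
    then obtain a where a: "\<exists>v\<in>f ` F. a v \<noteq> 0" "(\<Sum>v\<in>f ` F. a v *\<^sub>R v) = 0"
      using assms by (auto simp: dependent_finite)
    then have "(\<Sum>i\<in>F. a (f i) *\<^sub>R f i) = 0" by (simp add: sum.reindex[OF inj])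
    then have "\<forall>i\<in>F. a (f i) = 0"
      using f[unfolded independent_family_def, rule_format, of "\<lambda>i. a (f i)"] by blast
    with a(1) show False by blast
  qed
  ultimately show "inj_on f F \<and> independent (f ` F)" by blast
next
  assume f: "inj_on f F \<and> independent (f ` F)"
  show "independent_family f F" unfolding independent_family_def
  proof (intro allI impI)
    fix a assume a: "(\<Sum>i\<in>F. a i *\<^sub>R f i) = 0"
    define b where "b = a \<circ> the_inv_into F f"
    have b: "b (f i) = a i" if "i \<in> F" for i
      using f that by (simp add: b_def the_inv_into_f_f)
    then have "(\<Sum>v\<in>f ` F. b v *\<^sub>R v) = 0"
      using f a by (simp add: sum.reindex)
    then have "\<forall>v\<in>f ` F. b v = 0"
      using f assms by (auto simp: dependent_finite)
    then show "\<forall>i\<in>F. a i = 0" using b by auto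
  qed
qed

text \<open>Completing the set to a basis by coordinate vectors leaves out exactly the right number
  of coordinates.\<close>

lemma exists_separating_coordinates:
  fixes R :: "(real ^ 'c) set"
  assumes "independent R"
  shows "\<exists>C. card C = card R \<and> (\<forall>v\<in>span R. (\<forall>c\<in>C. v $ c = 0) \<longrightarrow> v = 0)"
proof -
  let ?e = "\<lambda>c::'c. axis c (1::real)"
  obtain B where B: "R \<subseteq> B" "B \<subseteq> R \<union> range ?e" "independent B" "R \<union> range ?e \<subseteq> span B"
    using maximal_independent_subset_extend[of R "R \<union> range ?e"] assms by blast
  have inj: "inj_on ?e D" for D by (auto simp: inj_on_def axis_eq_axis)
  define D where "D = {c. ?e c \<in> B - R}"
  have BR: "B - R = ?e ` D" using B(2) by (auto simp: D_def)
  have fin: "finite B" using B(3) by (rule independent_bound[THEN conjunct1])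
  have "Basis \<subseteq> span B"
    using B(4) by (auto simp: Basis_vec_def)
  then have "UNIV \<subseteq> span B"
    by (metis span_Basis span_minimal subspace_span)
  then have "card B = CARD('c)"
    using basis_card_eq_dim[of B UNIV] B(3) by simp
  moreover have "card B = card R + card D"
    using card_Un_disjoint[of R "B - R"] fin B(1) BR card_image[OF inj[of D]]
    by (metis Diff_disjoint Un_Diff_cancel finite_Diff finite_subset sup.absorb2)
  moreover have "card (- D) = CARD('c) - card D"
    by (simp add: Compl_eq_Diff_UNIV card_Diff_subset)
  ultimately have "card (- D) = card R" by simp
  moreover have "v = 0" if v: "v \<in> span R" "\<forall>c\<in>- D. v $ c = 0" for v
  proof -
    have finR: "finite R" using fin B(1) finite_subset by blast
    obtain a where a: "v = (\<Sum>r\<in>R. a r *\<^sub>R r)"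
      using v(1) by (auto simp: span_finite[OF finR])
    have "v = (\<Sum>c\<in>UNIV. v $ c *\<^sub>R ?e c)"
      using basis_expansion[of v] by (simp add: scalar_mult_eq_scaleR)
    also have "\<dots> = (\<Sum>c\<in>D. v $ c *\<^sub>R ?e c)"
      by (rule sum.mono_neutral_right) (use v(2) in auto)
    also have "\<dots> = (\<Sum>b\<in>B - R. (v \<bullet> b) *\<^sub>R b)"
      unfolding BR by (subst sum.reindex[OF inj]) (simp add: inner_axis)
    finally have v': "v = (\<Sum>b\<in>B - R. (v \<bullet> b) *\<^sub>R b)" .
    \<comment> \<open>The vector \<open>v\<close> is written once through \<open>R\<close> and once
      through the coordinate vectors in \<open>B - R\<close>; the difference of the two is a
      relation on the basis \<open>B\<close>, so its coefficients vanish.\<close>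
    define g where "g b = (if b \<in> R then a b else - (v \<bullet> b))" for b
    have "(\<Sum>b\<in>B. g b *\<^sub>R b) = (\<Sum>b\<in>R. g b *\<^sub>R b) + (\<Sum>b\<in>B - R. g b *\<^sub>R b)"
      using sum.subset_diff[OF B(1) fin, of "\<lambda>b. g b *\<^sub>R b"] by (simp add: add.commute)
    also have "(\<Sum>b\<in>R. g b *\<^sub>R b) = v" unfolding a by (rule sum.cong) (auto simp: g_def)
    also have "(\<Sum>b\<in>B - R. g b *\<^sub>R b) = - (\<Sum>b\<in>B - R. (v \<bullet> b) *\<^sub>R b)"
      unfolding sum_negf[symmetric] by (rule sum.cong) (auto simp: g_def)
    also have "\<dots> = - v" using v' by simp
    finally have "(\<Sum>b\<in>B. g b *\<^sub>R b) = 0" by simp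
    then have "\<forall>b\<in>B. g b = 0"
      using B(3) fin by (auto simp: dependent_finite)
    then have "\<forall>r\<in>R. a r = 0" using B(1) by (metis g_def subsetD)
    then show "v = 0" unfolding a by simp
  qed
  ultimately show ?thesis by blast
qed

text \<open>A vanishing determinant means a nonzero kernel vector of the transpose, whose entries
  are the coefficients of a relation among the rows on the chosen columns.\<close>

lemma submatrix_det_nonzero_iff:
  fixes A :: "'r \<Rightarrow> 'c \<Rightarrow> 'a::idom"
  assumes "distinct rs" "length rs = length cs"
  shows "submatrix_det A rs cs \<noteq> 0 \<longleftrightarrow>
    (\<forall>a. (\<forall>c\<in>set cs. (\<Sum>r\<in>set rs. a r * A r c) = 0) \<longrightarrow> (\<forall>r\<in>set rs. a r = 0))"
proof -
  let ?n = "length rs"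
  let ?M = "Matrix.mat ?n (length cs) (\<lambda>(i, j). A (rs ! i) (cs ! j))"
  have M: "?M \<in> carrier_mat ?n ?n" using assms(2) by simp
  have sum_rs: "(\<Sum>r\<in>set rs. h r) = (\<Sum>i\<in>{0..<?n}. h (rs ! i))" for h :: "'r \<Rightarrow> 'a"
    using assms(1) sum.reindex_bij_betw[OF bij_betw_nth[of rs "{0..<?n}" "set rs"], of h]
    by (simp add: atLeast0LessThan)
  have prod: "(transpose_mat ?M *\<^sub>v w = 0\<^sub>v ?n) \<longleftrightarrow>
      (\<forall>j<?n. (\<Sum>i\<in>{0..<?n}. Matrix.vec_index w i * A (rs ! i) (cs ! j)) = 0)"
    if "w \<in> carrier_vec ?n" for w
    using that assms(2)
    by (auto simp: vec_eq_iff scalar_prod_def mult.commute)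
  have "submatrix_det A rs cs = 0 \<longleftrightarrow> Determinant.det (transpose_mat ?M) = 0"
    unfolding submatrix_det_def by (simp add: det_transpose[OF M])
  also have "\<dots> \<longleftrightarrow> (\<exists>w. w \<in> carrier_vec ?n \<and> w \<noteq> 0\<^sub>v ?n \<and> transpose_mat ?M *\<^sub>v w = 0\<^sub>v ?n)"
    by (rule det_0_iff_vec_prod_zero) (use M in simp)
  also have "\<dots> \<longleftrightarrow> (\<exists>a. (\<forall>c\<in>set cs. (\<Sum>r\<in>set rs. a r * A r c) = 0) \<and> (\<exists>r\<in>set rs. a r \<noteq> 0))"
    (is "?L \<longleftrightarrow> ?R")
  proof
    assume ?L
    then obtain w where w: "w \<in> carrier_vec ?n" "w \<noteq> 0\<^sub>v ?n"
      "\<forall>j<?n. (\<Sum>i\<in>{0..<?n}. Matrix.vec_index w i * A (rs ! i) (cs ! j)) = 0"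
      using prod by blast
    \<comment> \<open>Entries of \<open>w\<close> are indexed by positions; distinctness of
      \<open>rs\<close> makes the position of a row unique, so they can be read as coefficients of
      rows.\<close>
    define a where "a r = Matrix.vec_index w (THE i. i < ?n \<and> rs ! i = r)" for r
    have a: "a (rs ! i) = Matrix.vec_index w i" if "i < ?n" for i
    proof -
      have "(THE k. k < ?n \<and> rs ! k = rs ! i) = i"
        using that assms(1) by (intro the_equality) (auto simp: nth_eq_iff_index_eq)
      then show ?thesis by (simp add: a_def)
    qed
    obtain i where "i < ?n" "Matrix.vec_index w i \<noteq> 0"
      using w(1,2) by (metis carrier_vecD eq_vecI index_zero_vec)
    then have "\<exists>r\<in>set rs. a r \<noteq> 0" using a by (metis nth_mem)
    moreover have "\<forall>c\<in>set cs. (\<Sum>r\<in>set rs. a r * A r c) = 0"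
      using w(3) a assms(2) by (auto simp: sum_rs in_set_conv_nth)
    ultimately show ?R by blast
  next
    assume ?R
    then obtain a where a: "\<forall>c\<in>set cs. (\<Sum>r\<in>set rs. a r * A r c) = 0" "\<exists>r\<in>set rs. a r \<noteq> 0"
      by blast
    define w where "w = Matrix.vec ?n (\<lambda>i. a (rs ! i))"
    have w: "w \<in> carrier_vec ?n" by (simp add: w_def)
    moreover have "w \<noteq> 0\<^sub>v ?n"
      using a(2) by (metis in_set_conv_nth index_vec index_zero_vec(1) w_def)
    moreover have "transpose_mat ?M *\<^sub>v w = 0\<^sub>v ?n"
    proof -
      have "\<forall>j<?n. (\<Sum>i\<in>{0..<?n}. Matrix.vec_index w i * A (rs ! i) (cs ! j)) = 0"
        using a(1) assms(2) by (simp add: w_def sum_rs)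
      then show ?thesis using prod[OF w] by blast
    qed
    ultimately show ?L by blast
  qed
  finally show ?thesis by blast
qed

text \<open>With the separating coordinates as columns, a relation among the rows that holds in
  these columns holds in all of them.\<close>

lemma exists_nonzero_minor:
  fixes f :: "'r \<Rightarrow> real ^ 'c"
  assumes "finite F" "independent_family f F"
  shows "\<exists>rs cs. distinct rs \<and> set rs = F \<and> distinct cs \<and> length rs = length cs \<and>
    submatrix_det (\<lambda>r c. f r $ c) rs cs \<noteq> 0"
proof -
  have f: "inj_on f F" "independent (f ` F)"
    using assms by (simp_all add: independent_family_iff)
  obtain C where C: "card C = card (f ` F)" "\<forall>v\<in>span (f ` F). (\<forall>c\<in>C. v $ c = 0) \<longrightarrow> v = 0"
    using exists_separating_coordinates[OF f(2)] by blast
  obtain rs where rs: "distinct rs" "set rs = F"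
    using finite_distinct_list[OF assms(1)] by blast
  obtain cs where cs: "distinct cs" "set cs = C"
    using finite_distinct_list[of C] by auto
  have len: "length rs = length cs"
    using C(1) f(1) rs cs distinct_card by (metis card_image)
  have "submatrix_det (\<lambda>r c. f r $ c) rs cs \<noteq> 0"
    unfolding submatrix_det_nonzero_iff[OF rs(1) len]
  proof (intro allI impI)
    fix a assume a: "\<forall>c\<in>set cs. (\<Sum>r\<in>set rs. a r * f r $ c) = 0"
    let ?v = "\<Sum>r\<in>F. a r *\<^sub>R f r"
    have "?v \<in> span (f ` F)" by (intro span_sum span_scale span_base) auto
    moreover have "\<forall>c\<in>C. ?v $ c = 0" using a cs rs by simp
    ultimately have "?v = 0" using C(2) by blast
    then show "\<forall>r\<in>set rs. a r = 0"
      using assms(2) rs(2) unfolding independent_family_def by blast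
  qed
  with rs cs len show ?thesis by blast
qed

lemma nonzero_minor_independent_family:
  fixes f :: "'r \<Rightarrow> real ^ 'c"
  assumes "distinct rs" "length rs = length cs" "submatrix_det (\<lambda>r c. f r $ c) rs cs \<noteq> 0"
  shows "independent_family f (set rs)"
  unfolding independent_family_def
proof (intro allI impI)
  fix a assume a: "(\<Sum>r\<in>set rs. a r *\<^sub>R f r) = 0"
  have "(\<Sum>r\<in>set rs. a r * f r $ c) = (\<Sum>r\<in>set rs. a r *\<^sub>R f r) $ c" for c by simp
  then have "(\<Sum>r\<in>set rs. a r * f r $ c) = 0" for c unfolding a by simp
  then show "\<forall>r\<in>set rs. a r = 0"
    using assms(3) unfolding submatrix_det_nonzero_iff[OF assms(1,2)] by blast
qed

text \<open>Independence at \<open>q\<close> is witnessed by a nonzero minor, which stays nonzero at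
  \<open>p\<close> and certifies independence there. All later transfers from \<open>q\<close> to
  \<open>p\<close> go through this statement.\<close>

lemma basis_generic_independent_rows:
  fixes p :: "'v::finite \<Rightarrow> real ^ 'd"
  assumes us: "is_basis_list us U" "(\<chi> v. q v) \<in> U" "basis_generic us p"
    and F: "F \<subseteq> complete_edges" "independent_family (rigidity_row q) F"
  shows "independent_family (rigidity_row p) F"
proof -
  have row: "(\<lambda>e c. rigidity_row r e $ c) = rigidity_entry (\<lambda>v j. r v $ j)" for r :: "'v \<Rightarrow> real ^ 'd"
    by (simp add: rigidity_row_def)
  obtain rs cs where m: "distinct rs" "set rs = F" "distinct cs" "length rs = length cs"
      "submatrix_det (rigidity_entry (\<lambda>v j. q v $ j)) rs cs \<noteq> 0"
    using exists_nonzero_minor[OF _ F(2)] unfolding row by auto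
  have "submatrix_det (rigidity_entry (\<lambda>v j. p v $ j)) rs cs \<noteq> 0"
    by (rule basis_generic_minor_nonzero[OF us m(1) _ m(3,4)]) (use F(1) m in simp_all)
  then show ?thesis
    using nonzero_minor_independent_family[OF m(1,4), of "rigidity_row p"] m(2) by (simp add: row)
qed

subsection \<open>Trivial motions\<close>

text \<open>\<open>A\<close> is the initial velocity field of a path \<open>Q\<close> of isometries
  starting at the identity. The derivative clauses speak of moving points \<open>f t\<close> instead
  of fixed ones, so that two such paths can be composed.\<close>

definition isometry_velocity :: "('a::real_inner \<Rightarrow> 'a) \<Rightarrow> bool" where
  "isometry_velocity A \<longleftrightarrow> (\<exists>Q :: real \<Rightarrow> 'a \<Rightarrow> 'a.
     (\<forall>t x y. norm (Q t x - Q t y) = norm (x - y)) \<and> (\<forall>x. Q 0 x = x) \<and>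
     (\<forall>f. (\<forall>t. f differentiable (at t)) \<longrightarrow> (\<forall>t. (\<lambda>t. Q t (f t)) differentiable (at t))) \<and>
     (\<forall>f f'. (f has_vector_derivative f') (at 0) \<longrightarrow>
        ((\<lambda>t. Q t (f t)) has_vector_derivative (f' + A (f 0))) (at 0)))"

lemma isometry_velocity_zero: "isometry_velocity (\<lambda>x. 0)"
  unfolding isometry_velocity_def by (rule exI[of _ "\<lambda>t x. x"]) simp

text \<open>Composing the paths adds their velocities at time 0, since the inner path starts at the
  identity.\<close>

lemma isometry_velocity_add:
  assumes "isometry_velocity A" "isometry_velocity B"
  shows "isometry_velocity (\<lambda>x. A x + B x)"
proof -
  obtain Q where Q: "\<And>t x y. norm (Q t x - Q t y) = norm (x - y)" "\<And>x. Q 0 x = x"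
     "\<And>f t. (\<forall>t. f differentiable (at t)) \<Longrightarrow> (\<lambda>t. Q t (f t)) differentiable (at t)"
     "\<And>f f'. (f has_vector_derivative f') (at 0) \<Longrightarrow>
        ((\<lambda>t. Q t (f t)) has_vector_derivative (f' + A (f 0))) (at (0::real))"
    using assms(1) unfolding isometry_velocity_def by blast
  obtain R where R: "\<And>t x y. norm (R t x - R t y) = norm (x - y)" "\<And>x. R 0 x = x"
     "\<And>f t. (\<forall>t. f differentiable (at t)) \<Longrightarrow> (\<lambda>t. R t (f t)) differentiable (at t)"
     "\<And>f f'. (f has_vector_derivative f') (at 0) \<Longrightarrow>
        ((\<lambda>t. R t (f t)) has_vector_derivative (f' + B (f 0))) (at (0::real))"
    using assms(2) unfolding isometry_velocity_def by blast
  have d: "((\<lambda>t. R t (Q t (f t))) has_vector_derivative (f' + (A (f 0) + B (f 0)))) (at 0)"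
    if "(f has_vector_derivative f') (at 0)" for f f'
    using R(4)[OF Q(4)[OF that]] Q(2) by (simp add: add.assoc)
  show ?thesis unfolding isometry_velocity_def
    by (rule exI[of _ "\<lambda>t x. R t (Q t x)"]) (simp add: Q(1,2,3) R(1,2,3) d)
qed

lemma isometry_velocity_sum:
  assumes "\<And>i. i \<in> I \<Longrightarrow> isometry_velocity (A i)"
  shows "isometry_velocity (\<lambda>x. \<Sum>i\<in>I. A i x)"
  using assms
  by (induction I rule: infinite_finite_induct)
    (simp_all add: isometry_velocity_zero isometry_velocity_add)

lemma norm_reflection:
  fixes w :: "'a::real_inner"
  assumes "norm w = 1"
  shows "norm (x - (2 * (w \<bullet> x)) *\<^sub>R w) = norm x"
proof -
  have "w \<bullet> w = 1" using assms by (simp add: norm_eq_1)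
  then show ?thesis
    by (simp add: norm_eq inner_diff_left inner_diff_right inner_commute algebra_simps)
qed

text \<open>The rotation is the product of the reflections in the hyperplanes orthogonal to \<open>i\<close> and to
  a unit vector turning from \<open>i\<close> towards \<open>j\<close> at half the speed.\<close>

lemma isometry_velocity_plane:
  fixes i j :: "'a::real_inner"
  assumes ij: "norm i = 1" "norm j = 1" "i \<bullet> j = 0"
  shows "isometry_velocity (\<lambda>x. c *\<^sub>R ((x \<bullet> j) *\<^sub>R i - (x \<bullet> i) *\<^sub>R j))"
proof -
  have ii: "i \<bullet> i = 1" "j \<bullet> j = 1" "j \<bullet> i = 0"
    using ij by (simp_all add: norm_eq_1 inner_commute)
  \<comment> \<open>The product of two reflections rotates by twice the angle between the normals of
    the mirrors; the half in the angle compensates for this, and the minus sign matches the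
    direction of the velocity field.\<close>
  define w where "w t = cos (- c * t / 2) *\<^sub>R i + sin (- c * t / 2) *\<^sub>R j" for t
  define w' where "w' t = (c / 2) *\<^sub>R (sin (- c * t / 2) *\<^sub>R i - cos (- c * t / 2) *\<^sub>R j)" for t
  have norm_w: "norm (w t) = 1" for t
    using sin_cos_squared_add[of "c * t / 2"]
    by (simp add: norm_eq_1 w_def inner_add_left inner_add_right inner_diff_left
        inner_diff_right ii ij power2_eq_square)
  have dw: "(w has_vector_derivative w' t) (at t)" for t
    unfolding w_def w'_def
    by (auto intro!: derivative_eq_intros simp: algebra_simps)
  define r where "r u x = x - (2 * (u \<bullet> x)) *\<^sub>R u" for u x :: 'a
  define Q where "Q t x = r (w t) (r i x)" for t x
  have r_diff: "r u x - r u y = r u (x - y)" for u x y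
    by (simp add: r_def inner_diff_right algebra_simps)
  have norm_r: "norm u = 1 \<Longrightarrow> norm (r u x) = norm x" for u x
    unfolding r_def by (rule norm_reflection)
  have dr: "((\<lambda>t. r (u t) (g t)) has_vector_derivative
      (r (u t) g' - 2 *\<^sub>R ((u' \<bullet> g t) *\<^sub>R u t + (u t \<bullet> g t) *\<^sub>R u'))) (at t)"
    if u: "(u has_vector_derivative u') (at t)" and g: "(g has_vector_derivative g') (at t)" for u g u' g' t
  proof -
    note inner = bounded_bilinear.has_vector_derivative[OF bounded_bilinear_inner u g]
    note scaled = bounded_bilinear.has_vector_derivative[OF bounded_bilinear_scaleR
        bounded_linear.has_vector_derivative[OF bounded_linear_mult_right[of 2] inner] u]
    show ?thesis unfolding r_def
      by (rule has_vector_derivative_eq_rhs[OF has_vector_derivative_diff[OF g scaled]])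
        (simp add: algebra_simps)
  qed
  have dQ: "((\<lambda>t. Q t (f t)) has_vector_derivative
      (r (w t) (r i f') - 2 *\<^sub>R ((w' t \<bullet> r i (f t)) *\<^sub>R w t + (w t \<bullet> r i (f t)) *\<^sub>R w' t))) (at t)"
    if "(f has_vector_derivative f') (at t)" for f f' t
    using dr[OF dw dr[OF has_vector_derivative_const that]] by (simp add: Q_def)
  have r_id: "r i (r i x) = x" for x
    by (simp add: r_def inner_diff_right ii algebra_simps)
  have w0: "w 0 = i" "w' 0 = (- c / 2) *\<^sub>R j" by (simp_all add: w_def w'_def)
  show ?thesis unfolding isometry_velocity_def
  proof (rule exI[of _ Q], intro conjI allI impI)
    show "norm (Q t x - Q t y) = norm (x - y)" for t x y
      by (simp add: Q_def r_diff norm_r norm_w ij)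
    show "Q 0 x = x" for x by (simp add: Q_def w0 r_id)
    show "(\<lambda>t. Q t (f t)) differentiable (at t)" if "\<forall>t. f differentiable (at t)" for f t
    proof -
      have "(f has_vector_derivative vector_derivative f (at t)) (at t)"
        using that by (simp add: vector_derivative_works)
      from dQ[OF this] show ?thesis by (rule differentiableI_vector)
    qed
    show "((\<lambda>t. Q t (f t)) has_vector_derivative (f' + c *\<^sub>R ((f 0 \<bullet> j) *\<^sub>R i - (f 0 \<bullet> i) *\<^sub>R j))) (at 0)"
      if "(f has_vector_derivative f') (at 0)" for f f'
      using dQ[OF that]
      by (rule has_vector_derivative_eq_rhs)
        (simp add: w0 r_id, simp add: r_def inner_diff_right ii ij inner_commute algebra_simps)
  qed
qed

text \<open>Expanding \<open>A\<close> in the orthonormal basis presents it as a combination of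
  infinitesimal rotations in coordinate planes; the factor 1/2 accounts for each plane occurring
  both as \<open>(i, j)\<close> and as \<open>(j, i)\<close>.\<close>

lemma skew_eq_sum_planes:
  fixes A :: "'a::euclidean_space \<Rightarrow> 'a"
  assumes "linear A" and skew: "\<And>x y. A x \<bullet> y = - (x \<bullet> A y)"
  shows "A x = (\<Sum>i\<in>Basis. \<Sum>j\<in>Basis. (A j \<bullet> i / 2) *\<^sub>R ((x \<bullet> j) *\<^sub>R i - (x \<bullet> i) *\<^sub>R j))"
proof -
  have expand: "A x = (\<Sum>j\<in>Basis. (x \<bullet> j) *\<^sub>R A j)"
    by (metis (no_types, lifting) assms(1) euclidean_representation linear_cmul linear_sum sum.cong)
  have "(\<Sum>i\<in>Basis. \<Sum>j\<in>Basis. (A j \<bullet> i * (x \<bullet> j)) *\<^sub>R i) =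
      (\<Sum>j\<in>Basis. (x \<bullet> j) *\<^sub>R (\<Sum>i\<in>Basis. (A j \<bullet> i) *\<^sub>R i))"
    by (subst sum.swap) (simp add: scaleR_sum_right mult.commute)
  then have 1: "(\<Sum>i\<in>Basis. \<Sum>j\<in>Basis. (A j \<bullet> i * (x \<bullet> j)) *\<^sub>R i) = A x"
    by (simp add: euclidean_representation expand)
  have "(\<Sum>i\<in>Basis. \<Sum>j\<in>Basis. (A j \<bullet> i * (x \<bullet> i)) *\<^sub>R j) =
      - (\<Sum>i\<in>Basis. (x \<bullet> i) *\<^sub>R (\<Sum>j\<in>Basis. (A i \<bullet> j) *\<^sub>R j))"
    unfolding scaleR_sum_right sum_negf[symmetric]
  proof (intro sum.cong refl)
    fix i j :: 'a
    show "(A j \<bullet> i * (x \<bullet> i)) *\<^sub>R j = - ((x \<bullet> i) *\<^sub>R ((A i \<bullet> j) *\<^sub>R j))"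
      using skew[of j i] by (simp add: inner_commute)
  qed
  then have 2: "(\<Sum>i\<in>Basis. \<Sum>j\<in>Basis. (A j \<bullet> i * (x \<bullet> i)) *\<^sub>R j) = - A x"
    by (simp add: euclidean_representation expand)
  have "(\<Sum>i\<in>Basis. \<Sum>j\<in>Basis. (A j \<bullet> i / 2) *\<^sub>R ((x \<bullet> j) *\<^sub>R i - (x \<bullet> i) *\<^sub>R j)) =
      (1/2) *\<^sub>R ((\<Sum>i\<in>Basis. \<Sum>j\<in>Basis. (A j \<bullet> i * (x \<bullet> j)) *\<^sub>R i)
             - (\<Sum>i\<in>Basis. \<Sum>j\<in>Basis. (A j \<bullet> i * (x \<bullet> i)) *\<^sub>R j))"
    by (simp add: scaleR_sum_right sum_subtractf scaleR_diff_right)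
  also have "\<dots> = A x" unfolding 1 2 by (simp add: scaleR_add_right[symmetric] scaleR_2[symmetric])
  finally show ?thesis by simp
qed

lemma skew_polarization:
  fixes A :: "'a::real_inner \<Rightarrow> 'a"
  assumes "linear A" "\<And>x. x \<bullet> A x = 0"
  shows "A x \<bullet> y = - (x \<bullet> A y)"
  using assms(2)[of "x + y"] assms(2)[of x] assms(2)[of y]
  by (simp add: linear_add[OF assms(1)] inner_add_left inner_add_right inner_commute)

lemma isometry_velocity_skew:
  fixes A :: "'a::euclidean_space \<Rightarrow> 'a"
  assumes "linear A" "\<And>x. x \<bullet> A x = 0"
  shows "isometry_velocity A"
proof -
  have "isometry_velocity (\<lambda>x. \<Sum>i\<in>Basis. \<Sum>j\<in>Basis.
      (A j \<bullet> i / 2) *\<^sub>R ((x \<bullet> j) *\<^sub>R i - (x \<bullet> i) *\<^sub>R j))"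
  proof (intro isometry_velocity_sum)
    fix i j :: 'a assume ij: "i \<in> Basis" "j \<in> Basis"
    show "isometry_velocity (\<lambda>x. (A j \<bullet> i / 2) *\<^sub>R ((x \<bullet> j) *\<^sub>R i - (x \<bullet> i) *\<^sub>R j))"
    proof (cases "i = j")
      case True
      then show ?thesis by (simp add: isometry_velocity_zero)
    next
      case False
      then show ?thesis using ij by (intro isometry_velocity_plane) (simp_all add: inner_Basis)
    qed
  qed
  then show ?thesis
    by (subst skew_eq_sum_planes[OF assms(1) skew_polarization[OF assms], abs_def])
qed

lemma trivial_motion_skew:
  fixes p :: "'v::finite \<Rightarrow> real ^ 'd"
  assumes "linear A" "\<And>x. x \<bullet> A x = 0"
  shows "trivial_motion p (\<lambda>v. A (p v) + b)"
proof -
  obtain Q where Q: "\<And>t x y. norm (Q t x - Q t y) = norm (x - y)" "\<And>x. Q 0 x = x"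
     "\<And>f t. (\<forall>t. f differentiable (at t)) \<Longrightarrow> (\<lambda>t. Q t (f t)) differentiable (at t)"
     "\<And>f f'. (f has_vector_derivative f') (at 0) \<Longrightarrow>
        ((\<lambda>t. Q t (f t)) has_vector_derivative (f' + A (f 0))) (at (0::real))"
    using isometry_velocity_skew[OF assms] unfolding isometry_velocity_def by blast
  define P where "P v t = Q t (p v) + t *\<^sub>R b" for v t
  show ?thesis unfolding trivial_motion_def
  proof (rule exI[of _ P], intro conjI allI ballI)
    show "P v differentiable_on {0..1}" for v
    proof -
      have "(\<lambda>t. Q t (p v)) differentiable (at t)" for t
        using Q(3)[of "\<lambda>t. p v"] by simp
      moreover have "(\<lambda>t. t *\<^sub>R b) differentiable (at t)" for t
        by (rule differentiableI_vector[of _ b]) (auto intro!: derivative_eq_intros)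
      ultimately have "P v differentiable (at t)" for t
        unfolding P_def by (rule differentiable_add)
      then show ?thesis by (simp add: differentiable_at_imp_differentiable_on)
    qed
    show "P v 0 = p v" for v by (simp add: P_def Q(2))
    show "norm (P v t - P w t) = norm (p v - p w)" for v w t
      by (simp add: P_def Q(1))
    show "(P v has_vector_derivative A (p v) + b) (at 0 within {0..1})" for v
    proof -
      have "((\<lambda>t. Q t (p v)) has_vector_derivative A (p v)) (at 0)"
        using Q(4)[of "\<lambda>t. p v" 0] by simp
      moreover have "((\<lambda>t. t *\<^sub>R b) has_vector_derivative b) (at 0)"
        by (auto intro!: derivative_eq_intros)
      ultimately have "(P v has_vector_derivative A (p v) + b) (at 0)"
        unfolding P_def by (rule has_vector_derivative_add)
      then show ?thesis by (rule has_vector_derivative_at_within)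
    qed
  qed
qed

lemma at_0_within_unit_interval: "at (0::real) within {0..1} \<noteq> bot"
  using trivial_limit_at_left_real by (simp add: at_within_Icc_at_right)

text \<open>The squared distance of two vertices is constant along the path; the vanishing of its
  one-sided derivative at 0 is the claim up to a factor 2.\<close>

lemma trivial_motion_infinitesimal:
  assumes "trivial_motion p u"
  shows "(p v - p w) \<bullet> (u v - u w) = 0"
proof -
  obtain P where P: "\<And>v. P v 0 = p v"
      "\<And>t v w. t \<in> {0..1} \<Longrightarrow> norm (P v t - P w t) = norm (p v - p w)"
      "\<And>v. (P v has_vector_derivative u v) (at 0 within {0..1})"
    using assms unfolding trivial_motion_def by blast
  have "((\<lambda>t. (P v t - P w t) \<bullet> (P v t - P w t)) has_vector_derivative
      (p v - p w) \<bullet> (u v - u w) + (u v - u w) \<bullet> (p v - p w)) (at 0 within {0..1})"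
    using bounded_bilinear.has_vector_derivative[OF bounded_bilinear_inner
        has_vector_derivative_diff[OF P(3)[of v] P(3)[of w]]
        has_vector_derivative_diff[OF P(3)[of v] P(3)[of w]]] by (simp add: P(1))
  moreover have "((\<lambda>t. (P v t - P w t) \<bullet> (P v t - P w t)) has_vector_derivative 0) (at 0 within {0..1})"
    by (rule has_vector_derivative_transform[OF _ _ has_vector_derivative_const[of "(p v - p w) \<bullet> (p v - p w)"]])
      (simp_all add: P(2) flip: norm_eq)
  ultimately have "(p v - p w) \<bullet> (u v - u w) + (u v - u w) \<bullet> (p v - p w) = 0"
    by (rule vector_derivative_unique_within[OF at_0_within_unit_interval])
  then show ?thesis by (simp add: inner_commute)
qed

section \<open>Affine dependences under trivial motions\<close>

text \<open>With weights of sum 0 the terms \<open>p i \<bullet> p i\<close> cancel, so the norm of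
  the combination is determined by mutual distances alone. A distance-preserving path therefore
  preserves affine dependences.\<close>

lemma norm_affine_dependence:
  fixes p :: "'i \<Rightarrow> 'a::real_inner"
  assumes "sum a I = 0"
  shows "(norm (\<Sum>i\<in>I. a i *\<^sub>R p i))\<^sup>2 = - (\<Sum>i\<in>I. \<Sum>j\<in>I. a i * a j * (norm (p i - p j))\<^sup>2) / 2"
proof -
  have 1: "(\<Sum>i\<in>I. \<Sum>j\<in>I. a i * a j * (p i \<bullet> p i)) = 0"
  proof (rule sum.neutral, rule ballI)
    fix i assume "i \<in> I"
    have "(\<Sum>j\<in>I. a i * a j * (p i \<bullet> p i)) = a i * (p i \<bullet> p i) * sum a I"
      by (simp add: sum_distrib_left sum_distrib_right mult_ac)
    then show "(\<Sum>j\<in>I. a i * a j * (p i \<bullet> p i)) = 0" using assms by simp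
  qed
  have 2: "(\<Sum>i\<in>I. \<Sum>j\<in>I. a i * a j * (p j \<bullet> p j)) = 0"
    by (subst sum.swap) (use 1 in \<open>simp add: mult_ac\<close>)
  have "(\<Sum>i\<in>I. \<Sum>j\<in>I. a i * a j * (norm (p i - p j))\<^sup>2) =
      (\<Sum>i\<in>I. \<Sum>j\<in>I. a i * a j * (p i \<bullet> p i) + a i * a j * (p j \<bullet> p j) - 2 * (a i * a j * (p i \<bullet> p j)))"
    by (intro sum.cong) (simp_all add: power2_norm_eq_inner inner_diff_left inner_diff_right
        inner_commute algebra_simps)
  also have "\<dots> = - 2 * (\<Sum>i\<in>I. \<Sum>j\<in>I. a i * a j * (p i \<bullet> p j))"
    by (simp add: sum.distrib sum_subtractf 1 2 sum_distrib_left sum_negf)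
  also have "(\<Sum>i\<in>I. \<Sum>j\<in>I. a i * a j * (p i \<bullet> p j)) = (norm (\<Sum>i\<in>I. a i *\<^sub>R p i))\<^sup>2"
    by (simp add: power2_norm_eq_inner inner_sum_left inner_sum_right sum_distrib_left
        inner_commute mult_ac)
  finally show ?thesis by simp
qed

text \<open>The dependence persists along the whole path because distances determine its norm;
  differentiating it at 0 gives the claim.\<close>

lemma trivial_motion_affine_dependence:
  assumes "trivial_motion p u" "sum a B = 0" "(\<Sum>v\<in>B. a v *\<^sub>R p v) = 0"
  shows "(\<Sum>v\<in>B. a v *\<^sub>R u v) = 0"
proof -
  obtain P where P: "\<And>t v w. t \<in> {0..1} \<Longrightarrow> norm (P v t - P w t) = norm (p v - p w)"
      "\<And>v. (P v has_vector_derivative u v) (at 0 within {0..1})"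
    using assms(1) unfolding trivial_motion_def by blast
  have P0: "(\<Sum>v\<in>B. a v *\<^sub>R P v t) = 0" if "t \<in> {0..1}" for t
  proof -
    have "(norm (\<Sum>v\<in>B. a v *\<^sub>R P v t))\<^sup>2 = (norm (\<Sum>v\<in>B. a v *\<^sub>R p v))\<^sup>2"
      using P(1)[OF that] by (simp add: norm_affine_dependence[OF assms(2)])
    then show ?thesis by (simp add: assms(3))
  qed
  have "((\<lambda>t. \<Sum>v\<in>B. a v *\<^sub>R P v t) has_vector_derivative (\<Sum>v\<in>B. a v *\<^sub>R u v)) (at 0 within {0..1})"
    by (intro has_vector_derivative_sum bounded_linear.has_vector_derivative[OF bounded_linear_scaleR_right] P)
  moreover have "((\<lambda>t. \<Sum>v\<in>B. a v *\<^sub>R P v t) has_vector_derivative 0) (at 0 within {0..1})"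
    by (rule has_vector_derivative_transform[OF _ _ has_vector_derivative_const[of 0]])
      (simp_all add: P0)
  ultimately show ?thesis
    by (rule vector_derivative_unique_within[OF at_0_within_unit_interval])
qed

definition affine_independent_family :: "('i \<Rightarrow> 'a::real_vector) \<Rightarrow> 'i set \<Rightarrow> bool" where
  "affine_independent_family p B \<longleftrightarrow>
     (\<forall>a. sum a B = 0 \<and> (\<Sum>i\<in>B. a i *\<^sub>R p i) = 0 \<longrightarrow> (\<forall>i\<in>B. a i = 0))"

lemma affine_independent_family_diff:
  assumes "affine_independent_family p B" "finite B" "i \<in> B"
  shows "independent_family (\<lambda>j. p j - p i) (B - {i})"
  unfolding independent_family_def
proof (intro allI impI)
  fix a assume a: "(\<Sum>j\<in>B - {i}. a j *\<^sub>R (p j - p i)) = 0"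
  \<comment> \<open>The weight at \<open>i\<close> is chosen so that all weights sum to 0, turning a
    linear relation among differences into an affine dependence of the points.\<close>
  define b where "b j = (if j = i then - sum a (B - {i}) else a j)" for j
  have "sum b B = b i + sum b (B - {i})" using assms by (simp add: sum.remove)
  also have "sum b (B - {i}) = sum a (B - {i})" by (rule sum.cong) (auto simp: b_def)
  finally have 1: "sum b B = 0" by (simp add: b_def)
  have "(\<Sum>j\<in>B. b j *\<^sub>R p j) = b i *\<^sub>R p i + (\<Sum>j\<in>B - {i}. b j *\<^sub>R p j)"
    using assms by (simp add: sum.remove)
  also have "(\<Sum>j\<in>B - {i}. b j *\<^sub>R p j) = (\<Sum>j\<in>B - {i}. a j *\<^sub>R p j)"
    by (rule sum.cong) (auto simp: b_def)
  also have "b i *\<^sub>R p i + \<dots> = (\<Sum>j\<in>B - {i}. a j *\<^sub>R (p j - p i))"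
    by (simp add: b_def scaleR_diff_right sum_subtractf scaleR_sum_left)
  finally have "(\<Sum>j\<in>B. b j *\<^sub>R p j) = 0" using a by simp
  with 1 assms(1) have "\<forall>j\<in>B. b j = 0" unfolding affine_independent_family_def by blast
  then show "\<forall>j\<in>B - {i}. a j = 0"
    unfolding b_def by (metis Diff_iff singletonI)
qed

section \<open>Extension of velocities to skew maps\<close>

lemma orthogonal_projection_exists:
  fixes W :: "'a::euclidean_space set"
  assumes "subspace W"
  shows "\<exists>\<pi>. linear \<pi> \<and> range \<pi> \<subseteq> W \<and> (\<forall>w\<in>W. \<pi> w = w) \<and> (\<forall>x y. \<pi> x \<bullet> y = x \<bullet> \<pi> y)"
proof -
  obtain C where C: "C \<subseteq> W" "pairwise Linear_Algebra.orthogonal C" "\<And>x. x \<in> C \<Longrightarrow> norm x = 1"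
      "independent C" "card C = dim W" "span C = W"
    using orthonormal_basis_subspace[OF assms] by blast
  have fin: "finite C" using C(4) independent_bound by blast
  define \<pi> where "\<pi> x = (\<Sum>c\<in>C. (x \<bullet> c) *\<^sub>R c)" for x
  have lin: "linear \<pi>"
    unfolding \<pi>_def by (auto intro!: linearI simp: inner_add_left scaleR_add_left sum.distrib scaleR_sum_right)
  have "\<pi> c = c" if "c \<in> C" for c
  proof -
    have "\<pi> c = (\<Sum>d\<in>C. if d = c then c else 0)" unfolding \<pi>_def
    proof (rule sum.cong)
      fix d assume "d \<in> C"
      then show "(c \<bullet> d) *\<^sub>R d = (if d = c then c else 0)"
        using C(2,3) that by (auto simp: pairwise_def Linear_Algebra.orthogonal_def norm_eq_1)
    qed simp
    then show ?thesis using that fin by simp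
  qed
  then have "\<pi> w = w" if "w \<in> W" for w
    using linear_eq_on[OF lin linear_id, of w C] that C(6) by simp
  moreover have "range \<pi> \<subseteq> W"
    unfolding \<pi>_def using C(1) assms by (auto intro!: subspace_sum subspace_scale)
  moreover have "\<pi> x \<bullet> y = x \<bullet> \<pi> y" for x y
    unfolding \<pi>_def by (simp add: inner_sum_left inner_sum_right inner_commute mult.commute)
  ultimately show ?thesis using lin by blast
qed

text \<open>A map that is skew on the span \<open>W\<close> of the edge vectors is made skew everywhere by letting
  it act on the orthogonal complement of \<open>W\<close> as minus the adjoint.\<close>

lemma affine_independent_motion_skew:
  fixes p u :: "'i \<Rightarrow> 'a::euclidean_space"
  assumes B: "affine_independent_family p B" "finite B"
    and u: "\<And>i j. i \<in> B \<Longrightarrow> j \<in> B \<Longrightarrow> (p i - p j) \<bullet> (u i - u j) = 0"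
  shows "\<exists>A b. linear A \<and> (\<forall>x. x \<bullet> A x = 0) \<and> (\<forall>i\<in>B. u i = A (p i) + b)"
proof (cases "B = {}")
  case True
  then show ?thesis by (intro exI[of _ "\<lambda>x. 0"]) (simp add: module_hom_zero linear_zero)
next
  case False
  then obtain k where k: "k \<in> B" by blast
  define w where "w i = p i - p k" for i
  have ind: "inj_on w (B - {k})" "independent (w ` (B - {k}))"
    using affine_independent_family_diff[OF B k] B(2)
    by (simp_all add: independent_family_iff w_def[abs_def])
  \<comment> \<open>The differences from \<open>p k\<close> are linearly independent, so a linear
    map may be prescribed on them; it sends each \<open>w i\<close> to the relative velocity
    \<open>u i - u k\<close>.\<close>
  obtain M where M: "linear M" "\<And>x. x \<in> w ` (B - {k}) \<Longrightarrow>
      M x = u (the_inv_into (B - {k}) w x) - u k"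
    using linear_independent_extend[OF ind(2), of "\<lambda>x. u (the_inv_into (B - {k}) w x) - u k"]
    by blast
  have Mw: "M (w i) = u i - u k" if "i \<in> B" for i
  proof (cases "i = k")
    case True
    then show ?thesis by (simp add: w_def linear_0[OF M(1)])
  next
    case False
    with that M(2)[of "w i"] ind(1) show ?thesis by (simp add: the_inv_into_f_f)
  qed
  define W where "W = span (w ` (B - {k}))"
  have skew_basis: "x \<bullet> M y + y \<bullet> M x = 0" if xy: "x \<in> w ` (B - {k})" "y \<in> w ` (B - {k})" for x y
  proof -
    obtain i j where ij: "i \<in> B" "j \<in> B" "x = w i" "y = w j" using xy by blast
    have "x \<bullet> M x = 0" "y \<bullet> M y = 0" "(x - y) \<bullet> (M x - M y) = 0"
      using u[OF ij(1) k] u[OF ij(2) k] u[OF ij(1,2)] ij Mw by (simp_all add: w_def)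
    then show ?thesis by (simp add: inner_diff_left inner_diff_right)
  qed
  have bil: "bilinear (\<lambda>x y. x \<bullet> M y + y \<bullet> M x)" "bilinear (\<lambda>x y. 0 :: real)"
    using M(1) by (auto simp: bilinear_def inner_add_left inner_add_right linear_add linear_cmul
        algebra_simps intro!: linearI)
  \<comment> \<open>A bilinear form that vanishes on pairs of spanning vectors vanishes on all of
    \<open>W\<close>; the case \<open>y = x\<close> is skewness.\<close>
  have "x \<bullet> M y + y \<bullet> M x = 0" if "x \<in> W" "y \<in> W" for x y
    by (rule bilinear_eq[OF bil _ _ that skew_basis]) (simp_all add: W_def)
  then have skewW: "x \<bullet> M x = 0" if "x \<in> W" for x using that by fastforce
  obtain \<pi> where \<pi>: "linear \<pi>" "range \<pi> \<subseteq> W" "\<And>x. x \<in> W \<Longrightarrow> \<pi> x = x" "\<And>x y. \<pi> x \<bullet> y = x \<bullet> \<pi> y"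
    using orthogonal_projection_exists[of W] unfolding W_def by auto
  define A where "A x = M (\<pi> x) - \<pi> (adjoint M (x - \<pi> x))" for x
  have linA: "linear A"
    unfolding A_def using M(1) \<pi>(1) adjoint_linear[OF M(1)]
    by (intro linear_compose_sub linear_compose[of \<pi> M, unfolded o_def]
        linear_compose[of "\<lambda>x. adjoint M (x - \<pi> x)" \<pi>, unfolded o_def]
        linear_compose[of "\<lambda>x. x - \<pi> x" "adjoint M", unfolded o_def] linear_ident) auto
  have "x \<bullet> A x = 0" for x
  proof -
    have "x \<bullet> A x = x \<bullet> M (\<pi> x) - \<pi> x \<bullet> adjoint M (x - \<pi> x)"
      by (simp add: A_def inner_diff_right \<pi>(4))
    \<comment> \<open>The contribution of \<open>M (\<pi> x)\<close> along
      \<open>x - \<pi> x\<close> is cancelled by the adjoint term, leaving the form on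
      \<open>W\<close>, where \<open>M\<close> is skew.\<close>
    also have "\<dots> = \<pi> x \<bullet> M (\<pi> x)"
      using adjoint_works[OF M(1), of "\<pi> x" "x - \<pi> x"]
      by (simp add: inner_diff_left inner_diff_right inner_commute)
    also have "\<dots> = 0" using skewW \<pi>(2) by blast
    finally show ?thesis .
  qed
  moreover have "u i = A (p i) + (u k - A (p k))" if "i \<in> B" for i
  proof -
    have "w i \<in> W"
    proof (cases "i = k")
      case True
      then show ?thesis by (simp add: w_def W_def span_zero)
    next
      case False
      then show ?thesis using that by (auto simp: W_def intro: span_base)
    qed
    then have "A (w i) = M (w i)" 
      by (simp add: A_def \<pi>(3) linear_0[OF \<pi>(1)] linear_0[OF adjoint_linear[OF M(1)]])
    then have "A (p i) - A (p k) = u i - u k"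
      using Mw[OF that] by (simp add: w_def linear_diff[OF linA])
    then show ?thesis by (simp add: algebra_simps)
  qed
  ultimately show ?thesis using linA by blast
qed

subsection \<open>Infinitesimal rigidity\<close>

definition flatten :: "('v::finite \<Rightarrow> real ^ 'd) \<Rightarrow> real ^ ('v \<times> 'd)" where
  "flatten u = (\<chi> c. u (fst c) $ snd c)"

lemma flatten_surj: "\<exists>u. y = flatten u"
  by (rule exI[of _ "\<lambda>v. \<chi> j. y $ (v, j)"]) (simp add: flatten_def Finite_Cartesian_Product.vec_eq_iff)

lemma flatten_eq_iff [simp]: "flatten u = flatten u' \<longleftrightarrow> u = u'"
  by (auto simp: flatten_def Finite_Cartesian_Product.vec_eq_iff fun_eq_iff)

lemma flatten_zero [simp]: "flatten (\<lambda>v. 0) = 0"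
  by (simp add: flatten_def Finite_Cartesian_Product.vec_eq_iff)

lemma rigidity_entry_edge:
  assumes "v \<noteq> w"
  shows "rigidity_entry q {v, w} (v, j) = q v j - q w j"
    and "rigidity_entry q {v, w} (w, j) = q w j - q v j"
proof -
  have "(THE x. {v, w} = {v, x}) = w" "(THE x. {v, w} = {w, x}) = v"
    using assms by (auto intro!: the_equality simp: doubleton_eq_iff)
  then show "rigidity_entry q {v, w} (v, j) = q v j - q w j"
    and "rigidity_entry q {v, w} (w, j) = q w j - q v j"
    by (simp_all add: rigidity_entry_def)
qed

lemma rigidity_row_inner:
  assumes "v \<noteq> w"
  shows "rigidity_row p {v, w} \<bullet> flatten u = (p v - p w) \<bullet> (u v - u w)"
proof -
  let ?e = "\<lambda>x j. rigidity_entry (\<lambda>v j. p v $ j) {v, w} (x, j) * u x $ j"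
  have "rigidity_row p {v, w} \<bullet> flatten u = (\<Sum>x\<in>UNIV. \<Sum>j\<in>UNIV. ?e x j)"
    by (simp add: inner_vec_def rigidity_row_def flatten_def sum.cartesian_product case_prod_unfold)
  also have "\<dots> = (\<Sum>x\<in>{v, w}. \<Sum>j\<in>UNIV. ?e x j)"
    by (rule sum.mono_neutral_right) (auto simp: rigidity_entry_def)
  also have "\<dots> = (p v - p w) \<bullet> u v + (p w - p v) \<bullet> u w"
    using assms by (simp add: rigidity_entry_edge inner_vec_def)
  finally show ?thesis by (simp add: inner_diff_left inner_diff_right)
qed

lemma infinitesimal_motion_iff:
  assumes "F \<subseteq> complete_edges"
  shows "infinitesimal_motion F p u \<longleftrightarrow> (\<forall>e\<in>F. rigidity_row p e \<bullet> flatten u = 0)"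
proof
  assume m: "infinitesimal_motion F p u"
  show "\<forall>e\<in>F. rigidity_row p e \<bullet> flatten u = 0"
  proof
    fix e assume "e \<in> F"
    moreover from this obtain v w where "e = {v, w}" "v \<noteq> w"
      using assms by (auto simp: complete_edges_def card_2_iff)
    ultimately show "rigidity_row p e \<bullet> flatten u = 0"
      using m by (simp add: infinitesimal_motion_def rigidity_row_inner)
  qed
next
  assume m: "\<forall>e\<in>F. rigidity_row p e \<bullet> flatten u = 0"
  show "infinitesimal_motion F p u" unfolding infinitesimal_motion_def
  proof (intro allI impI)
    fix v w assume "{v, w} \<in> F"
    moreover from this have "v \<noteq> w" using assms by (auto simp: complete_edges_def)
    ultimately show "(p v - p w) \<bullet> (u v - u w) = 0"
      using m rigidity_row_inner[of v w p u] by auto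
  qed
qed

section \<open>Simplices, stresses and affine independence\<close>

definition simplex_edges :: "'v::finite set \<Rightarrow> 'v set set" where
  "simplex_edges B = {e. e \<subseteq> B \<and> card e = 2}"

lemma simplex_edges_subset: "simplex_edges B \<subseteq> complete_edges"
  by (auto simp: simplex_edges_def complete_edges_def)

text \<open>This is the resultant at \<open>v\<close> of the stress \<open>a\<close>: rows of edges
  missing \<open>v\<close> vanish in its columns, and the edges at \<open>v\<close> correspond to
  the other vertices of \<open>B\<close>.\<close>

lemma sum_simplex_rows:
  assumes "v \<in> B"
  shows "(\<Sum>e\<in>simplex_edges B. a e *\<^sub>R rigidity_row p e) $ (v, j) =
    (\<Sum>w\<in>B - {v}. a {v, w} *\<^sub>R (p v - p w)) $ j"
proof -
  let ?t = "\<lambda>e. a e * rigidity_entry (\<lambda>v j. p v $ j) e (v, j)"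
  have inj: "inj_on (\<lambda>w. {v, w}) (B - {v})" by (auto simp: inj_on_def doubleton_eq_iff)
  have "e \<in> (\<lambda>w. {v, w}) ` (B - {v})" if "e \<in> simplex_edges B" "v \<in> e" for e
  proof -
    have "card e = 2" using that by (simp add: simplex_edges_def)
    then obtain x y where "e = {x, y}" "x \<noteq> y" by (metis card_2_iff)
    then show ?thesis using that by (auto simp: simplex_edges_def)
  qed
  then have "?t e = 0" if "e \<in> simplex_edges B - (\<lambda>w. {v, w}) ` (B - {v})" for e
    using that by (auto simp: rigidity_entry_def)
  moreover have "(\<lambda>w. {v, w}) ` (B - {v}) \<subseteq> simplex_edges B"
    using assms by (auto simp: simplex_edges_def)
  ultimately have "(\<Sum>e\<in>simplex_edges B. ?t e) = (\<Sum>e\<in>(\<lambda>w. {v, w}) ` (B - {v}). ?t e)"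
    by (intro sum.mono_neutral_right) auto
  also have "\<dots> = (\<Sum>w\<in>B - {v}. a {v, w} * (p v $ j - p w $ j))"
    unfolding sum.reindex[OF inj] o_def
  proof (rule sum.cong)
    fix w assume "w \<in> B - {v}"
    then have "v \<noteq> w" by blast
    then show "?t {v, w} = a {v, w} * (p v $ j - p w $ j)" by (simp add: rigidity_entry_edge)
  qed simp
  finally show ?thesis by (simp add: rigidity_row_def)
qed

text \<open>A relation among the rows is read in the columns of one endpoint \<open>v\<close>: there
  it becomes a relation among the differences \<open>p w - p v\<close>, which are
  independent.\<close>

lemma affine_independent_imp_simplex_rows_independent:
  assumes "affine_independent_family p B"
  shows "independent_family (rigidity_row p) (simplex_edges B)"
  unfolding independent_family_def
proof (intro allI impI ballI)
  fix a e assume a: "(\<Sum>e\<in>simplex_edges B. a e *\<^sub>R rigidity_row p e) = 0"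
    and e: "e \<in> simplex_edges B"
  obtain v w where vw: "e = {v, w}" "v \<in> B" "w \<in> B - {v}"
    using e by (auto simp: simplex_edges_def card_2_iff)
  have "(\<Sum>w\<in>B - {v}. a {v, w} *\<^sub>R (p v - p w)) = 0"
    using sum_simplex_rows[OF vw(2), of a p] a by (simp add: Finite_Cartesian_Product.vec_eq_iff)
  moreover have "(\<Sum>w\<in>B - {v}. a {v, w} *\<^sub>R (p w - p v)) = - (\<Sum>w\<in>B - {v}. a {v, w} *\<^sub>R (p v - p w))"
    unfolding sum_negf[symmetric] by (simp add: scaleR_diff_right)
  ultimately have "(\<Sum>w\<in>B - {v}. a {v, w} *\<^sub>R (p w - p v)) = 0" by simp
  then show "a e = 0"
    using affine_independent_family_diff[OF assms _ vw(2)] vw(1,3)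
    unfolding independent_family_def by auto
qed

text \<open>An affine dependence \<open>b\<close> of the points yields the stress \<open>b v * b w\<close> on the edges.\<close>

lemma simplex_rows_independent_imp_affine_independent:
  assumes "independent_family (rigidity_row p) (simplex_edges B)"
  shows "affine_independent_family p B"
  unfolding affine_independent_family_def
proof (intro allI impI)
  fix b assume b: "sum b B = 0 \<and> (\<Sum>v\<in>B. b v *\<^sub>R p v) = 0"
  define a where "a e = prod b e" for e
  have "(\<Sum>e\<in>simplex_edges B. a e *\<^sub>R rigidity_row p e) $ (v, j) = 0" for v j
  proof (cases "v \<in> B")
    case True
    have "(\<Sum>w\<in>B - {v}. a {v, w} *\<^sub>R (p v - p w)) = (\<Sum>w\<in>B - {v}. (b v * b w) *\<^sub>R (p v - p w))"
    proof (rule sum.cong)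
      fix w assume "w \<in> B - {v}"
      then have "v \<noteq> w" by blast
      then show "a {v, w} *\<^sub>R (p v - p w) = (b v * b w) *\<^sub>R (p v - p w)" by (simp add: a_def)
    qed simp
    also have "\<dots> = (\<Sum>w\<in>B. (b v * b w) *\<^sub>R (p v - p w))"
      by (rule sum.mono_neutral_left) auto
    also have "\<dots> = b v *\<^sub>R (sum b B *\<^sub>R p v - (\<Sum>w\<in>B. b w *\<^sub>R p w))"
      by (simp add: scaleR_diff_right sum_subtractf scaleR_sum_left scaleR_sum_right)
    also have "\<dots> = 0" using b by simp
    finally show ?thesis unfolding sum_simplex_rows[OF True] by simp
  next
    case False
    then show ?thesis
      by (auto simp: rigidity_row_def rigidity_entry_def simplex_edges_def intro!: sum.neutral)
  qed
  then have "(\<Sum>e\<in>simplex_edges B. a e *\<^sub>R rigidity_row p e) = 0"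
    by (simp add: Finite_Cartesian_Product.vec_eq_iff split_paired_all)
  then have a0: "a e = 0" if "e \<in> simplex_edges B" for e
    using assms that unfolding independent_family_def by blast
  \<comment> \<open>All products of weights at two different vertices vanish, so at most one weight
    is nonzero; the sum 0 excludes even that one.\<close>
  show "\<forall>v\<in>B. b v = 0"
  proof (rule ballI, rule ccontr)
    fix v assume v: "v \<in> B" "b v \<noteq> 0"
    have "b w = 0" if "w \<in> B - {v}" for w
      using a0[of "{v, w}"] that v by (auto simp: simplex_edges_def a_def)
    then have "sum b B = b v" using v(1) by (simp add: sum.remove[of B v])
    with b v(2) show False by simp
  qed
qed

section \<open>Dimensions of motion spaces\<close>

lemma inner_span_eq_0_iff: "(\<forall>x\<in>span S. x \<bullet> y = 0) \<longleftrightarrow> (\<forall>x\<in>S. x \<bullet> y = 0)"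
proof
  assume S: "\<forall>x\<in>S. x \<bullet> y = 0"
  have "Linear_Algebra.orthogonal y x" if "x \<in> span S" for x
    by (rule orthogonal_to_span[OF that]) (use S in \<open>simp add: Linear_Algebra.orthogonal_def inner_commute\<close>)
  then show "\<forall>x\<in>span S. x \<bullet> y = 0"
    by (simp add: Linear_Algebra.orthogonal_def inner_commute)
qed (simp add: span_base)

text \<open>Independent constraints each lower the dimension by one. The ambient \<open>X\<close>
  will be the whole space or the space of velocities supported on a simplex.\<close>

lemma dim_orthogonal_family:
  fixes f :: "'i \<Rightarrow> 'a::euclidean_space"
  assumes "subspace X" "f ` F \<subseteq> X" "finite F" "independent_family f F"
  shows "dim {y \<in> X. \<forall>i\<in>F. f i \<bullet> y = 0} + card F = dim X"
proof -
  have f: "inj_on f F" "independent (f ` F)"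
    using assms by (simp_all add: independent_family_iff)
  have "(\<forall>x\<in>span (f ` F). Linear_Algebra.orthogonal x y) \<longleftrightarrow> (\<forall>i\<in>F. f i \<bullet> y = 0)" for y
    using inner_span_eq_0_iff[of "f ` F" y] by (simp add: Linear_Algebra.orthogonal_def)
  then have "{y \<in> X. \<forall>x\<in>span (f ` F). Linear_Algebra.orthogonal x y} = {y \<in> X. \<forall>i\<in>F. f i \<bullet> y = 0}"
    by simp
  moreover have "dim (span (f ` F)) = card F"
    using f by (simp add: dim_eq_card_independent card_image)
  moreover have "span (f ` F) \<subseteq> X" using assms(1,2) by (rule span_minimal[rotated])
  ultimately show ?thesis
    using dim_subspace_orthogonal_to_vectors[OF subspace_span assms(1), of "f ` F"] by simp
qed

definition motion_space :: "'v::finite set set \<Rightarrow> ('v \<Rightarrow> real ^ 'd) \<Rightarrow> (real ^ ('v \<times> 'd)) set" where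
  "motion_space F p = {y. \<forall>e\<in>F. rigidity_row p e \<bullet> y = 0}"

lemma subspace_motion_space: "subspace (motion_space F p)"
  by (auto simp: motion_space_def subspace_def inner_add_right)

text \<open>Edges whose rows form a basis of the row space at \<open>q\<close> define the same
  motions there as \<open>E\<close>. Their rows remain independent at \<open>p\<close>, so they
  leave a space of equal dimension, which contains the motions of \<open>E\<close> at
  \<open>p\<close>.\<close>

lemma dim_motion_space_le:
  fixes p q :: "'v::finite \<Rightarrow> real ^ 'd"
  assumes "E \<subseteq> complete_edges"
    and ind: "\<And>F. F \<subseteq> complete_edges \<Longrightarrow> independent_family (rigidity_row q) F \<Longrightarrow>
      independent_family (rigidity_row p) F"
  shows "dim (motion_space E p) \<le> dim (motion_space E q)"
proof -
  obtain R where R: "R \<subseteq> rigidity_row q ` E" "independent R" "rigidity_row q ` E \<subseteq> span R"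
    using maximal_independent_subset by blast
  then obtain F where F: "F \<subseteq> E" "inj_on (rigidity_row q) F" "R = rigidity_row q ` F"
    by (auto simp: subset_image_inj)
  have indq: "independent_family (rigidity_row q) F"
    using F(2,3) R(2) by (simp add: independent_family_iff)
  then have indp: "independent_family (rigidity_row p) F"
    using ind F(1) assms(1) by blast
  have "motion_space E q = motion_space F q"
  proof
    show "motion_space E q \<subseteq> motion_space F q" using F(1) by (auto simp: motion_space_def)
    show "motion_space F q \<subseteq> motion_space E q"
    proof
      fix y assume y: "y \<in> motion_space F q"
      then have "\<forall>x\<in>span R. x \<bullet> y = 0"
        unfolding inner_span_eq_0_iff F(3) by (simp add: motion_space_def)
      then show "y \<in> motion_space E q"
        using R(3) by (auto simp: motion_space_def)
    qed
  qed
  moreover have "dim (motion_space F q) = dim (motion_space F p)"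
    using dim_orthogonal_family[of UNIV "rigidity_row q" F] indq
      dim_orthogonal_family[of UNIV "rigidity_row p" F] indp
    by (simp add: motion_space_def)
  moreover have "dim (motion_space E p) \<le> dim (motion_space F p)"
    using F(1) by (intro dim_subset) (auto simp: motion_space_def)
  ultimately show ?thesis by simp
qed

text \<open>The condition on \<open>A\<close> says that it is skew-symmetric; these are the
  velocities at the points of \<open>p\<close> under infinitesimal isometries of the space.\<close>

definition trivial_space :: "('v::finite \<Rightarrow> real ^ 'd) \<Rightarrow> (real ^ ('v \<times> 'd)) set" where
  "trivial_space p = {flatten (\<lambda>v. A (p v) + b) | A b. linear A \<and> (\<forall>x. x \<bullet> A x = 0)}"

lemma subspace_trivial_space: "subspace (trivial_space p)"
proof (rule subspaceI)
  have "linear (\<lambda>x::real ^ 'd. 0 :: real ^ 'd)" by (auto intro: linearI)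
  then show "0 \<in> trivial_space p"
    unfolding trivial_space_def by (intro CollectI exI[of _ "\<lambda>x. 0"] exI[of _ 0]) simp
next
  fix y z assume "y \<in> trivial_space p" "z \<in> trivial_space p"
  then obtain A b A' b' where *: "y = flatten (\<lambda>v. A (p v) + b)" "linear A" "\<forall>x. x \<bullet> A x = 0"
    "z = flatten (\<lambda>v. A' (p v) + b')" "linear A'" "\<forall>x. x \<bullet> A' x = 0"
    unfolding trivial_space_def by blast
  then have "y + z = flatten (\<lambda>v. (A (p v) + A' (p v)) + (b + b'))"
    by (simp add: flatten_def Finite_Cartesian_Product.vec_eq_iff)
  moreover have "linear (\<lambda>x. A x + A' x)" using * by (intro linear_compose_add)
  ultimately show "y + z \<in> trivial_space p"
    unfolding trivial_space_def using *
    by (intro CollectI exI[of _ "\<lambda>x. A x + A' x"] exI[of _ "b + b'"]) (simp add: inner_add_right)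
next
  fix c y assume "y \<in> trivial_space p"
  then obtain A b where *: "y = flatten (\<lambda>v. A (p v) + b)" "linear A" "\<forall>x. x \<bullet> A x = 0"
    unfolding trivial_space_def by blast
  then have "c *\<^sub>R y = flatten (\<lambda>v. c *\<^sub>R A (p v) + c *\<^sub>R b)"
    by (simp add: flatten_def Finite_Cartesian_Product.vec_eq_iff distrib_left)
  moreover have "linear (\<lambda>x. c *\<^sub>R A x)" using * by (intro linear_compose_scale_right)
  ultimately show "c *\<^sub>R y \<in> trivial_space p"
    unfolding trivial_space_def using *
    by (intro CollectI exI[of _ "\<lambda>x. c *\<^sub>R A x"] exI[of _ "c *\<^sub>R b"]) simp
qed

lemma trivial_motion_if_trivial_space:
  assumes "flatten u \<in> trivial_space p"
  shows "trivial_motion p u"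
  using assms trivial_motion_skew by (auto simp: trivial_space_def)

lemma trivial_space_subset_motion_space:
  assumes "E \<subseteq> complete_edges"
  shows "trivial_space p \<subseteq> motion_space E p"
proof
  fix y assume y: "y \<in> trivial_space p"
  obtain u where u: "y = flatten u" using flatten_surj by blast
  then have "trivial_motion p u" using y trivial_motion_if_trivial_space by blast
  then have "infinitesimal_motion E p u"
    using trivial_motion_infinitesimal by (auto simp: infinitesimal_motion_def)
  then show "y \<in> motion_space E p"
    using infinitesimal_motion_iff[OF assms, of p u] by (simp add: motion_space_def u)
qed

text \<open>By maximality every vertex outside \<open>B\<close> is affinely dependent on
  \<open>B\<close>. Trivial motions respect such dependences, so one that vanishes on
  \<open>B\<close> vanishes at that vertex as well.\<close>

lemma exists_maximal_affine_independent:
  fixes q :: "'v::finite \<Rightarrow> real ^ 'd"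
  shows "\<exists>B. affine_independent_family q B \<and>
    (\<forall>u. trivial_motion q u \<and> (\<forall>v\<in>B. u v = 0) \<longrightarrow> u = (\<lambda>v. 0))"
proof -
  have "affine_independent_family q {}" by (simp add: affine_independent_family_def)
  then obtain B where B: "affine_independent_family q B"
    "\<And>C. affine_independent_family q C \<Longrightarrow> B \<subseteq> C \<Longrightarrow> B = C"
    using finite_has_maximal[of "{B. affine_independent_family q B}"] by auto
  have "u v = 0" if u: "trivial_motion q u" "\<forall>v\<in>B. u v = 0" for u v
  proof (cases "v \<in> B")
    case True
    then show ?thesis using u by simp
  next
    case False
    then have "\<not> affine_independent_family q (insert v B)" using B(2) by blast
    then obtain a where a: "sum a (insert v B) = 0" "(\<Sum>i\<in>insert v B. a i *\<^sub>R q i) = 0"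
      "\<exists>i\<in>insert v B. a i \<noteq> 0"
      unfolding affine_independent_family_def by blast
    have "a v \<noteq> 0"
    proof
      assume "a v = 0"
      with a False have "sum a B = 0 \<and> (\<Sum>i\<in>B. a i *\<^sub>R q i) = 0" by simp
      with B(1) have "\<forall>i\<in>B. a i = 0" unfolding affine_independent_family_def by blast
      with a(3) \<open>a v = 0\<close> show False by auto
    qed
    moreover have "(\<Sum>i\<in>insert v B. a i *\<^sub>R u i) = 0"
      by (rule trivial_motion_affine_dependence[OF u(1) a(1,2)])
    ultimately show ?thesis using False u(2) by simp
  qed
  with B(1) show ?thesis by blast
qed

text \<open>On a maximal affinely independent set \<open>B\<close> of vertices of the rigid framework, the motions
  that both frameworks induce on the simplex \<open>B\<close> have the same dimension. Hence the trivial motions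
  of \<open>p\<close> are at least as many as those of \<open>q\<close>, which are all motions of \<open>q\<close>.\<close>

lemma infinitesimally_rigid_transfer:
  fixes p q :: "'v::finite \<Rightarrow> real ^ 'd"
  assumes E: "E \<subseteq> complete_edges"
    and rigid: "infinitesimally_rigid E q"
    and ind: "\<And>F. F \<subseteq> complete_edges \<Longrightarrow> independent_family (rigidity_row q) F \<Longrightarrow>
      independent_family (rigidity_row p) F"
  shows "infinitesimally_rigid E p"
proof -
  obtain B where B: "affine_independent_family q B"
    and extend: "\<And>u. trivial_motion q u \<Longrightarrow> (\<forall>v\<in>B. u v = 0) \<Longrightarrow> u = (\<lambda>v. 0)"
    using exists_maximal_affine_independent[of q] by blast
  have indq: "independent_family (rigidity_row q) (simplex_edges B)"
    by (rule affine_independent_imp_simplex_rows_independent[OF B])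
  have indp: "independent_family (rigidity_row p) (simplex_edges B)"
    by (rule ind[OF simplex_edges_subset indq])
  have Bp: "affine_independent_family p B"
    by (rule simplex_rows_independent_imp_affine_independent[OF indp])
  \<comment> \<open>Restriction of velocities to \<open>B\<close>, realised within the same vector
    space by setting them to 0 elsewhere.\<close>
  define \<rho> where "\<rho> y = (\<chi> c. if fst c \<in> B then y $ c else 0)" for y :: "real ^ ('v \<times> 'd)"
  have lin: "linear \<rho>" by (rule linearI) (auto simp: \<rho>_def Finite_Cartesian_Product.vec_eq_iff)
  have \<rho>_flatten: "\<rho> (flatten u) = flatten (\<lambda>v. if v \<in> B then u v else 0)" for u
    by (simp add: \<rho>_def flatten_def Finite_Cartesian_Product.vec_eq_iff)
  define X where "X = {y :: real ^ ('v \<times> 'd). \<forall>c. fst c \<notin> B \<longrightarrow> y $ c = 0}"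
  have subX: "subspace X" by (auto simp: X_def subspace_def)
  have rowX: "rigidity_row r ` simplex_edges B \<subseteq> X" for r :: "'v \<Rightarrow> real ^ 'd"
    by (auto simp: X_def rigidity_row_def rigidity_entry_def simplex_edges_def)
  \<comment> \<open>The infinitesimal motions of the simplex on \<open>B\<close>, at rest outside.
    For both frameworks their dimension is that of \<open>X\<close> minus the number of edges of the
    simplex.\<close>
  define D where "D r = {y \<in> X. \<forall>e\<in>simplex_edges B. rigidity_row r e \<bullet> y = 0}" for r
  have dimD: "dim (D q) = dim (D p)"
    using dim_orthogonal_family[OF subX rowX _ indq] dim_orthogonal_family[OF subX rowX _ indp]
    unfolding D_def by simp
  have D_flatten: "flatten u \<in> D r \<longleftrightarrow> (\<forall>v. v \<notin> B \<longrightarrow> u v = 0) \<and>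
      (\<forall>v\<in>B. \<forall>w\<in>B. (r v - r w) \<bullet> (u v - u w) = 0)" for u r
  proof -
    have "(\<forall>e\<in>simplex_edges B. rigidity_row r e \<bullet> flatten u = 0) \<longleftrightarrow>
        infinitesimal_motion (simplex_edges B) r u"
      by (rule infinitesimal_motion_iff[OF simplex_edges_subset, symmetric])
    also have "\<dots> \<longleftrightarrow> (\<forall>v\<in>B. \<forall>w\<in>B. (r v - r w) \<bullet> (u v - u w) = 0)"
    proof
      assume m: "infinitesimal_motion (simplex_edges B) r u"
      show "\<forall>v\<in>B. \<forall>w\<in>B. (r v - r w) \<bullet> (u v - u w) = 0"
      proof (intro ballI)
        fix v w assume "v \<in> B" "w \<in> B"
        then show "(r v - r w) \<bullet> (u v - u w) = 0"
          using m by (cases "v = w") (auto simp: infinitesimal_motion_def simplex_edges_def)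
      qed
    next
      assume "\<forall>v\<in>B. \<forall>w\<in>B. (r v - r w) \<bullet> (u v - u w) = 0"
      then show "infinitesimal_motion (simplex_edges B) r u"
        by (simp add: infinitesimal_motion_def simplex_edges_def)
    qed
    finally show ?thesis
      by (auto simp: D_def X_def flatten_def Finite_Cartesian_Product.vec_eq_iff)
  qed
  have trivial: "trivial_motion q u" if "flatten u \<in> motion_space E q" for u
    using that rigid infinitesimal_motion_iff[OF E, of q u]
    by (simp add: infinitesimally_rigid_def motion_space_def)
  \<comment> \<open>Motions of the rigid framework are trivial, and a trivial motion at rest on
    \<open>B\<close> is zero; hence restriction loses no dimension.\<close>
  have "dim (motion_space E q) = dim (\<rho> ` motion_space E q)"
  proof (rule dim_image_eq[OF lin, symmetric])
    have "y = 0" if y: "y \<in> motion_space E q" "\<rho> y = 0" for y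
    proof -
      obtain u where u: "y = flatten u" using flatten_surj by blast
      then have "flatten (\<lambda>v. if v \<in> B then u v else 0) = flatten (\<lambda>v. 0)"
        using y(2) by (simp add: \<rho>_flatten)
      then have "\<forall>v\<in>B. u v = 0" unfolding flatten_eq_iff by (metis (full_types))
      then show ?thesis using extend trivial y(1) u by fastforce
    qed
    then show "inj_on \<rho> (span (motion_space E q))"
      unfolding linear_inj_on_iff_eq_0[OF lin subspace_span]
      by (metis span_eq_iff subspace_motion_space)
  qed
  also have "\<dots> \<le> dim (D q)"
  proof (rule dim_subset, rule image_subsetI)
    fix y assume y: "y \<in> motion_space E q"
    obtain u where u: "y = flatten u" using flatten_surj by blast
    show "\<rho> y \<in> D q"
      using trivial_motion_infinitesimal[OF trivial] y
      by (auto simp: u \<rho>_flatten D_flatten)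
  qed
  also note dimD
  \<comment> \<open>A motion of an affinely independent simplex comes from an infinitesimal
    isometry, so it is the restriction of a trivial motion of the whole framework.\<close>
  also have "dim (D p) \<le> dim (\<rho> ` trivial_space p)"
  proof (rule dim_subset, rule subsetI)
    fix y assume y: "y \<in> D p"
    obtain u where u: "y = flatten u" using flatten_surj by blast
    obtain A b where A: "linear A" "\<forall>x. x \<bullet> A x = 0" "\<forall>v\<in>B. u v = A (p v) + b"
      using affine_independent_motion_skew[OF Bp, of u] y unfolding u D_flatten by auto
    have "y = \<rho> (flatten (\<lambda>v. A (p v) + b))"
      using y A(3) by (auto simp: u D_flatten \<rho>_flatten)
    with A(1,2) show "y \<in> \<rho> ` trivial_space p" unfolding trivial_space_def by blast
  qed
  also have "\<dots> \<le> dim (trivial_space p)" by (rule dim_image_le[OF lin])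
  finally have "dim (motion_space E q) \<le> dim (trivial_space p)" .
  moreover have "dim (motion_space E p) \<le> dim (motion_space E q)"
    by (rule dim_motion_space_le[OF E ind])
  ultimately have "dim (motion_space E p) \<le> dim (trivial_space p)" by simp
  \<comment> \<open>The inclusion of these trivial motions in all motions becomes an equality once
    the dimensions permit no gap.\<close>
  then have "trivial_space p = motion_space E p"
    using subspace_dim_equal[OF subspace_trivial_space subspace_motion_space]
      trivial_space_subset_motion_space[OF E] by blast
  then show ?thesis
    using infinitesimal_motion_iff[OF E, of p] trivial_motion_if_trivial_space
    by (fastforce simp: infinitesimally_rigid_def motion_space_def)
qed

subsection \<open>Symmetry-generic realizations\<close>

text \<open>The inverse in a group record is a definite description over the carrier; identifying it
  with the inverse map makes it comparable between different groups of maps.\<close>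

lemma orthogonal_group_inverse:
  fixes x :: "real ^ 'd \<Rightarrow> real ^ 'd"
  assumes "x \<in> carrier orthogonal_group"
  shows "inv\<^bsub>orthogonal_group\<^esub> x = inv_into UNIV x" "x \<circ> inv_into UNIV x = id" "inv_into UNIV x \<circ> x = id"
proof -
  have x: "orthogonal_transformation x" using assms by (simp add: orthogonal_group_def)
  then have bij: "bij x" by (rule orthogonal_transformation_bij)
  then show id: "x \<circ> inv_into UNIV x = id" "inv_into UNIV x \<circ> x = id"
    by (simp_all add: bij_is_inj bij_is_surj surj_iff[symmetric])
  show "inv\<^bsub>orthogonal_group\<^esub> x = inv_into UNIV x"
    unfolding m_inv_def
  proof (rule the_equality)
    show "inv_into UNIV x \<in> carrier orthogonal_group \<and> x \<otimes>\<^bsub>orthogonal_group\<^esub> inv_into UNIV x = \<one>\<^bsub>orthogonal_group\<^esub> \<and>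
        inv_into UNIV x \<otimes>\<^bsub>orthogonal_group\<^esub> x = \<one>\<^bsub>orthogonal_group\<^esub>"
      using x id by (simp add: orthogonal_group_def orthogonal_transformation_inv)
    show "y = inv_into UNIV x" if "y \<in> carrier orthogonal_group \<and> x \<otimes>\<^bsub>orthogonal_group\<^esub> y = \<one>\<^bsub>orthogonal_group\<^esub> \<and>
        y \<otimes>\<^bsub>orthogonal_group\<^esub> x = \<one>\<^bsub>orthogonal_group\<^esub>" for y
      using that by (simp add: orthogonal_group_def inv_unique_comp[of x y])
  qed
qed

text \<open>Elements of \<open>S\<close> are isometries, and \<open>\<Phi>\<close> supplies the
  automorphisms that make them symmetry operations. The subgroup laws carry over because both groups
  multiply by composition.\<close>

lemma realizations_of_typeI:
  fixes p :: "'v::finite \<Rightarrow> real ^ 'd"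
  assumes S: "symmetry_group S" and \<Phi>: "\<Phi> \<in> S \<rightarrow> graph_automorphisms E"
    and p: "framework E p" "(\<chi> v. p v) \<in> symmetric_subspace S \<Phi>"
  shows "p \<in> realizations_of_type E S \<Phi>"
proof -
  have sub: "subgroup S orthogonal_group" using S by (simp add: symmetry_group_def)
  have orth: "orthogonal_transformation x" if "x \<in> S" for x
    using subgroup.mem_carrier[OF sub that] by (simp add: orthogonal_group_def)
  have sym: "x (p v) = p (\<Phi> x v)" if "x \<in> S" for x v
    using p(2) that by (simp add: symmetric_subspace_def)
  have op: "x \<in> carrier (point_group E p)" if "x \<in> S" for x
    using orth[OF that] \<Phi> sym[OF that] that
    by (auto simp: point_group_def symmetry_operation_def orthogonal_transformation_isometry)
  have "subgroup S (point_group E p)"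
  proof
    show "S \<subseteq> carrier (point_group E p)" using op by blast
    show "x \<otimes>\<^bsub>point_group E p\<^esub> y \<in> S" if "x \<in> S" "y \<in> S" for x y
      using subgroup.m_closed[OF sub that] by (simp add: point_group_def orthogonal_group_def)
    show "\<one>\<^bsub>point_group E p\<^esub> \<in> S"
      using subgroup.one_closed[OF sub] by (simp add: point_group_def orthogonal_group_def)
    show "inv\<^bsub>point_group E p\<^esub> x \<in> S" if "x \<in> S" for x
    proof -
      \<comment> \<open>Closure of \<open>S\<close> under inverses is known with respect to the
        orthogonal group; the description of the inverse is evaluated again over the point
        group.\<close>
      note x = orthogonal_group_inverse[OF subgroup.mem_carrier[OF sub that]]
      have invS: "inv_into UNIV x \<in> S" using subgroup.m_inv_closed[OF sub that] by (simp add: x)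
      have "inv\<^bsub>point_group E p\<^esub> x = inv_into UNIV x"
        unfolding m_inv_def
      proof (rule the_equality)
        show "inv_into UNIV x \<in> carrier (point_group E p) \<and> x \<otimes>\<^bsub>point_group E p\<^esub> inv_into UNIV x = \<one>\<^bsub>point_group E p\<^esub> \<and>
            inv_into UNIV x \<otimes>\<^bsub>point_group E p\<^esub> x = \<one>\<^bsub>point_group E p\<^esub>"
          using op[OF invS] x by (simp add: point_group_def)
        show "y = inv_into UNIV x" if "y \<in> carrier (point_group E p) \<and>
            x \<otimes>\<^bsub>point_group E p\<^esub> y = \<one>\<^bsub>point_group E p\<^esub> \<and> y \<otimes>\<^bsub>point_group E p\<^esub> x = \<one>\<^bsub>point_group E p\<^esub>" for y
          using that by (simp add: point_group_def inv_unique_comp[of x y])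
      qed
      then show ?thesis using invS by simp
    qed
  qed
  then show ?thesis using p(1) sym by (simp add: realizations_of_type_def realizations_def)
qed

lemma realizations_of_typeD:
  assumes "p \<in> realizations_of_type E S \<Phi>"
  shows "framework E p" "(\<chi> v. p v) \<in> symmetric_subspace S \<Phi>"
  using assms by (auto simp: realizations_of_type_def realizations_def symmetric_subspace_def)

lemma subspace_symmetric_subspace:
  assumes "symmetry_group S"
  shows "subspace (symmetric_subspace S \<Phi>)"
proof -
  have "linear x" if "x \<in> S" for x
    using subgroup.mem_carrier[OF assms[unfolded symmetry_group_def] that]
    by (simp add: orthogonal_group_def orthogonal_transformation_linear)
  then show ?thesis
    by (auto simp: symmetric_subspace_def subspace_def linear_0 linear_add linear_cmul)
qed

lemma exists_basis_list:
  fixes U :: "'a::euclidean_space set"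
  assumes "subspace U"
  shows "\<exists>us. is_basis_list us U"
proof -
  obtain B where B: "B \<subseteq> U" "independent B" "U \<subseteq> span B"
    using maximal_independent_subset by blast
  have "span B = U" using B span_minimal[OF B(1) assms] by blast
  moreover obtain us where "distinct us" "set us = B"
    using finite_distinct_list independent_bound[OF B(2)] by blast
  ultimately show ?thesis using B(2) unfolding is_basis_list_def by blast
qed

section \<open>Existence of generic realizations\<close>

lemma rigidity_row_eq_0_iff:
  assumes "v \<noteq> w"
  shows "rigidity_row p {v, w} = 0 \<longleftrightarrow> p v = p w"
proof
  assume "rigidity_row p {v, w} = 0"
  then have "rigidity_row p {v, w} $ (v, j) = 0" for j by simp
  then show "p v = p w"
    using assms by (simp add: rigidity_row_def rigidity_entry_edge Finite_Cartesian_Product.vec_eq_iff)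
next
  assume "p v = p w"
  have "rigidity_entry (\<lambda>v j. p v $ j) {v, w} (x, j) = 0" for x j
    using assms \<open>p v = p w\<close> by (cases "x \<in> {v, w}") (auto simp: rigidity_entry_edge, auto simp: rigidity_entry_def)
  then show "rigidity_row p {v, w} = 0" by (simp add: rigidity_row_def Finite_Cartesian_Product.vec_eq_iff split_paired_all)
qed

lemma independent_family_singleton: "independent_family f {i} \<longleftrightarrow> f i \<noteq> 0"
  by (simp add: independent_family_iff)

text \<open>A single row is independent iff it is nonzero, that is, iff the ends of its edge lie at
  different points; this transfers from \<open>q\<close> to \<open>p\<close> edge by edge.\<close>

lemma basis_generic_framework:
  fixes p q :: "'v::finite \<Rightarrow> real ^ 'd"
  assumes E: "simple_graph E"
    and us: "is_basis_list us U" "(\<chi> v. q v) \<in> U" "basis_generic us p"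
    and q: "framework E q"
  shows "framework E p"
  unfolding framework_def
proof (intro allI impI)
  fix v w assume vw: "{v, w} \<in> E"
  then have "card {v, w} = 2" using E by (simp add: simple_graph_def)
  then have "v \<noteq> w" by auto
  moreover have "independent_family (rigidity_row p) {{v, w}}"
    by (rule basis_generic_independent_rows[OF us])
      (use q vw \<open>v \<noteq> w\<close> in \<open>auto simp: complete_edges_def independent_family_singleton
        rigidity_row_eq_0_iff framework_def\<close>)
  ultimately show "p v \<noteq> p w"
    by (simp add: independent_family_singleton rigidity_row_eq_0_iff)
qed

text \<open>The given realization \<open>q\<close> lies in the symmetric subspace and serves to keep
  adjacent vertices of the generic configuration apart.\<close>

lemma exists_symmetry_generic:
  fixes E :: "'v::finite set set" and S :: "(real ^ 'd \<Rightarrow> real ^ 'd) set"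
  assumes "simple_graph E" "symmetry_group S" "\<Phi> \<in> S \<rightarrow> graph_automorphisms E"
    and "realizations_of_type E S \<Phi> \<noteq> {}"
  shows "\<exists>p. symmetry_generic E S \<Phi> p"
proof -
  obtain q where q: "framework E q" "(\<chi> v. q v) \<in> symmetric_subspace S \<Phi>"
    using assms(4) realizations_of_typeD by blast
  obtain us :: "(real ^ 'd ^ 'v) list" where us: "is_basis_list us (symmetric_subspace S \<Phi>)"
    using exists_basis_list[OF subspace_symmetric_subspace[OF assms(2)]] by blast
  obtain r where r: "r \<in> symmetric_subspace S \<Phi>" "basis_generic us (\<lambda>v. r $ v)"
    using exists_basis_generic[OF us] by blast
  have "(\<lambda>v. r $ v) \<in> realizations_of_type E S \<Phi>"
    using realizations_of_typeI[OF assms(2,3) basis_generic_framework[OF assms(1) us q(2) r(2) q(1)]]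
      r(1) by simp
  then show ?thesis using us r(2) unfolding symmetry_generic_def by blast
qed

theorem theorem4p5:
  fixes E :: "'v::finite set set"
    and S :: "(real ^ 'd \<Rightarrow> real ^ 'd) set"
    and \<Phi> :: "(real ^ 'd \<Rightarrow> real ^ 'd) \<Rightarrow> 'v \<Rightarrow> 'v"
  assumes "simple_graph E"
    and "symmetry_group S"
    and "\<Phi> \<in> S \<rightarrow> graph_automorphisms E"
    and "realizations_of_type E S \<Phi> \<noteq> {}"
  shows
    "((\<exists>p\<in>realizations_of_type E S \<Phi>. infinitesimally_rigid E p) \<longleftrightarrow>
        (\<forall>p. symmetry_generic E S \<Phi> p \<longrightarrow> infinitesimally_rigid E p)) \<and>
     ((\<exists>p\<in>realizations_of_type E S \<Phi>. independent_framework E p) \<longleftrightarrow>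
        (\<forall>p. symmetry_generic E S \<Phi> p \<longrightarrow> independent_framework E p)) \<and>
     ((\<exists>p\<in>realizations_of_type E S \<Phi>. isostatic E p) \<longleftrightarrow>
        (\<forall>p. symmetry_generic E S \<Phi> p \<longrightarrow> isostatic E p))"
proof -
  have E: "E \<subseteq> complete_edges"
    using assms(1) by (auto simp: simple_graph_def complete_edges_def)
  \<comment> \<open>Any realization of the prescribed type may act as \<open>q\<close>: it lies in
    the symmetric subspace, whichever basis makes \<open>p\<close> generic.\<close>
  have ind: "independent_family (rigidity_row p) F"
    if "q \<in> realizations_of_type E S \<Phi>" "symmetry_generic E S \<Phi> p"
      "F \<subseteq> complete_edges" "independent_family (rigidity_row q) F" for p q F
    using that basis_generic_independent_rows[OF _ realizations_of_typeD(2)]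
    unfolding symmetry_generic_def by blast
  have rigid: "infinitesimally_rigid E p"
    if "q \<in> realizations_of_type E S \<Phi>" "symmetry_generic E S \<Phi> p" "infinitesimally_rigid E q" for p q
    using infinitesimally_rigid_transfer[OF E that(3) ind[OF that(1,2)]] .
  have independent: "independent_framework E p"
    if "q \<in> realizations_of_type E S \<Phi>" "symmetry_generic E S \<Phi> p" "independent_framework E q" for p q
    using ind[OF that(1,2) E] that(3)
    by (simp add: independent_framework_def independent_family_iff)
  \<comment> \<open>A generic realization must exist lest condition (ii) hold vacuously;
    \<open>p0\<close> carries the property in the direction from (ii) to (i).\<close>
  obtain p0 where p0: "symmetry_generic E S \<Phi> p0"
    using exists_symmetry_generic[OF assms] by blast
  then have "p0 \<in> realizations_of_type E S \<Phi>" by (simp add: symmetry_generic_def)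
  with p0 rigid independent show ?thesis unfolding isostatic_def by blast
qed

end
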